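(* Let $G$ act on a hyperbolic space $X$, and suppose $H_1,\dots,H_k$ are subgroups of $G$ such that $(G,X,H_i)$ is an A/QI triple for each $i=1,\dots,k$ and $\Lambda(H_i)\cap\Lambda(H_j)=\emptyset$ for all $i\neq j$. Then there exists a finite collection of elements $\mathcal S\subset \bigcup_{i=1}^k H_i\setminus\{1\}$ such that for any family of subgroups $\mathcal K=\{K_i\}_{i=1}^k$ with $K_i$ quasi-isometrically embedded in $H_i$ and satisfying $K_i\cap\mathcal S=\emptyset$ for all $i$, we have $K=\langle \bigcup\mathcal K\rangle\cong K_1*K_2*\cdots*K_k$ and $(G,X,K)$ is an A/QI triple.
   Context: A hyperbolic space is a Gromov hyperbolic geodesic metric space $(X,d)$; all actions are by isometries. Acylindricity along a subset: for $Y\subseteq X$, an action $G\curvearrowright X$ is acylindrical along $Y$ if for every $\varepsilon\ge 0$ there are $R=R(\varepsilon,Y)>0$ and $M=M(\varepsilon,Y)>0$ so that, whenever $x,y\in Y$ satisfy $d(x,y)\ge R$, $\#\{g\in G\mid d(gx,x)\le\varepsilon \text{ and } d(gy,y)\le\varepsilon\}\le M$. For $H<G$, the action is acylindrical along $H$ if it is acylindrical along the orbit $Hx$ for some (equivalently any) $x\in X$. A finitely generated subgroup $H<G$ is quasi-isometrically embedded by the action if the orbit map $h\mapsto hx$ (for $x\in X$) is a quasi-isometric embedding of $H$, with a word metric from a finite generating set, into $X$. An A/QI triple $(G,X,H)$ consists of a Gromov hyperbolic space $X$ and an action $G\curvearrowright X$ which is acylindrical along the finitely generated infinite subgroup $H$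 of $G$, and so that $H$ is quasi-isometrically embedded by the action. A subgroup $K_i\le H_i$ is quasi-isometrically embedded in $H_i$ if it is finitely generated and the inclusion is a quasi-isometric embedding for word metrics. $\langle\bigcup\mathcal K\rangle$ is the subgroup of $G$ generated by the union of the $K_i$. Limit set: for a subset $T\subseteq G$, $\Lambda(T)\subseteq\partial X$ (the Gromov boundary, i.e. equivalence classes of sequences converging to infinity) is the set of $p\in\partial X$ with $p=\lim_{n\to\infty} t_nx_0$ for some sequence $t_n\in T$, where $x_0\in X$ is a base point; it does not depend on $x_0$.
   Formalization: (G,X,K) is concluded to be an A/QI triple only when K is infinite, since the claim fails for finite K (e.g. all K_i trivial); the free product decomposition, acylindricity along K and quasi-isometric embedding of K are concluded for every K. *)

theory Defs
  imports
    "HOL-Analysis.Abstract_Metric_Spaces"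
    "HOL-Algebra.Group_Action"
    "HOL-Algebra.Generated_Groups"
begin

section \<open>Hyperbolic spaces and the Gromov boundary\<close>

definition gromov_product :: "('x \<Rightarrow> 'x \<Rightarrow> real) \<Rightarrow> 'x \<Rightarrow> 'x \<Rightarrow> 'x \<Rightarrow> real" where
  "gromov_product d w x y = (d x w + d y w - d x y) / 2"

definition geodesic_metric_space :: "'x set \<Rightarrow> ('x \<Rightarrow> 'x \<Rightarrow> real) \<Rightarrow> bool" where
  "geodesic_metric_space X d \<longleftrightarrow> Metric_space X d \<and>
     (\<forall>x\<in>X. \<forall>y\<in>X. \<exists>\<gamma> :: real \<Rightarrow> 'x.
        \<gamma> ` {0..d x y} \<subseteq> X \<and> \<gamma> 0 = x \<and> \<gamma> (d x y) = y \<and>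
        (\<forall>s\<in>{0..d x y}. \<forall>t\<in>{0..d x y}. d (\<gamma> s) (\<gamma> t) = \<bar>s - t\<bar>))"

definition gromov_hyperbolic :: "'x set \<Rightarrow> ('x \<Rightarrow> 'x \<Rightarrow> real) \<Rightarrow> bool" where
  "gromov_hyperbolic X d \<longleftrightarrow>
     (\<exists>\<delta>\<ge>0. \<forall>w\<in>X. \<forall>x\<in>X. \<forall>y\<in>X. \<forall>z\<in>X.
        gromov_product d w x z \<ge> min (gromov_product d w x y) (gromov_product d w y z) - \<delta>)"

definition hyperbolic_space :: "'x set \<Rightarrow> ('x \<Rightarrow> 'x \<Rightarrow> real) \<Rightarrow> bool" where
  "hyperbolic_space X d \<longleftrightarrow> geodesic_metric_space X d \<and> gromov_hyperbolic X d"

definition converges_to_infinity ::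
    "'x set \<Rightarrow> ('x \<Rightarrow> 'x \<Rightarrow> real) \<Rightarrow> 'x \<Rightarrow> (nat \<Rightarrow> 'x) \<Rightarrow> bool" where
  "converges_to_infinity X d w s \<longleftrightarrow> range s \<subseteq> X \<and>
     filterlim (\<lambda>(m, n). gromov_product d w (s m) (s n)) at_top (sequentially \<times>\<^sub>F sequentially)"

definition boundary_rel ::
    "'x set \<Rightarrow> ('x \<Rightarrow> 'x \<Rightarrow> real) \<Rightarrow> 'x \<Rightarrow> ((nat \<Rightarrow> 'x) \<times> (nat \<Rightarrow> 'x)) set" where
  "boundary_rel X d w =
     {(s, t). converges_to_infinity X d w s \<and> converges_to_infinity X d w t \<and>
        filterlim (\<lambda>(m, n). gromov_product d w (s m) (t n)) at_top (sequentially \<times>\<^sub>F sequentially)}"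

definition gromov_boundary ::
    "'x set \<Rightarrow> ('x \<Rightarrow> 'x \<Rightarrow> real) \<Rightarrow> 'x \<Rightarrow> (nat \<Rightarrow> 'x) set set" where
  "gromov_boundary X d w = {s. converges_to_infinity X d w s} // boundary_rel X d w"

section \<open>Isometric actions\<close>

definition isometric_action ::
    "('g, 'b) monoid_scheme \<Rightarrow> 'x set \<Rightarrow> ('x \<Rightarrow> 'x \<Rightarrow> real) \<Rightarrow> ('g \<Rightarrow> 'x \<Rightarrow> 'x) \<Rightarrow> bool" where
  "isometric_action G X d \<phi> \<longleftrightarrow> group_action G X \<phi> \<and>
     (\<forall>g\<in>carrier G. \<forall>x\<in>X. \<forall>y\<in>X. d (\<phi> g x) (\<phi> g y) = d x y)"

text \<open>A boundary point is a class of sequences, so a sequence in \<open>X\<close> converges to the boundary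
  point \<open>p\<close> iff it is a member of \<open>p\<close>. The point \<open>w\<close> serves both as base point of the orbit
  and as base point of the Gromov products.\<close>
definition limit_set ::
    "'x set \<Rightarrow> ('x \<Rightarrow> 'x \<Rightarrow> real) \<Rightarrow> ('g \<Rightarrow> 'x \<Rightarrow> 'x) \<Rightarrow> 'x \<Rightarrow> 'g set \<Rightarrow> (nat \<Rightarrow> 'x) set set" where
  "limit_set X d \<phi> w T =
     {p \<in> gromov_boundary X d w. \<exists>t. (\<forall>n. t n \<in> T) \<and> (\<lambda>n. \<phi> (t n) w) \<in> p}"

definition acylindrical_along ::
    "('g, 'b) monoid_scheme \<Rightarrow> ('x \<Rightarrow> 'x \<Rightarrow> real) \<Rightarrow> ('g \<Rightarrow> 'x \<Rightarrow> 'x) \<Rightarrow> 'x set \<Rightarrow> bool" where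
  "acylindrical_along G d \<phi> Y \<longleftrightarrow>
     (\<forall>\<epsilon>\<ge>0. \<exists>R>0. \<exists>M>0. \<forall>x\<in>Y. \<forall>y\<in>Y. d x y \<ge> R \<longrightarrow>
        finite {g \<in> carrier G. d (\<phi> g x) x \<le> \<epsilon> \<and> d (\<phi> g y) y \<le> \<epsilon>} \<and>
        real (card {g \<in> carrier G. d (\<phi> g x) x \<le> \<epsilon> \<and> d (\<phi> g y) y \<le> \<epsilon>}) \<le> M)"

definition acylindrical_along_subgroup ::
    "('g, 'b) monoid_scheme \<Rightarrow> 'x set \<Rightarrow> ('x \<Rightarrow> 'x \<Rightarrow> real) \<Rightarrow> ('g \<Rightarrow> 'x \<Rightarrow> 'x) \<Rightarrow> 'g set \<Rightarrow> bool"
  where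
  "acylindrical_along_subgroup G X d \<phi> H \<longleftrightarrow>
     (\<exists>x\<in>X. acylindrical_along G d \<phi> ((\<lambda>h. \<phi> h x) ` H))"

section \<open>Word metrics and quasi-isometric embeddings\<close>

definition word_prod :: "('g, 'b) monoid_scheme \<Rightarrow> 'g list \<Rightarrow> 'g" where
  "word_prod G gs = foldr (\<lambda>g h. g \<otimes>\<^bsub>G\<^esub> h) gs \<one>\<^bsub>G\<^esub>"

text \<open>The word length is only meaningful on the subgroup generated by \<open>S\<close>.\<close>
definition word_length :: "('g, 'b) monoid_scheme \<Rightarrow> 'g set \<Rightarrow> 'g \<Rightarrow> nat" where
  "word_length G S g =
     (LEAST n. \<exists>gs. length gs = n \<and> set gs \<subseteq> S \<union> m_inv G ` S \<and> word_prod G gs = g)"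

definition word_dist :: "('g, 'b) monoid_scheme \<Rightarrow> 'g set \<Rightarrow> 'g \<Rightarrow> 'g \<Rightarrow> real" where
  "word_dist G S g h = real (word_length G S (inv\<^bsub>G\<^esub> g \<otimes>\<^bsub>G\<^esub> h))"

definition finite_generating_set :: "('g, 'b) monoid_scheme \<Rightarrow> 'g set \<Rightarrow> 'g set \<Rightarrow> bool" where
  "finite_generating_set G H S \<longleftrightarrow> finite S \<and> S \<subseteq> H \<and> generate G S = H"

definition quasi_isometric_embedding ::
    "'a set \<Rightarrow> ('a \<Rightarrow> 'a \<Rightarrow> real) \<Rightarrow> ('c \<Rightarrow> 'c \<Rightarrow> real) \<Rightarrow> ('a \<Rightarrow> 'c) \<Rightarrow> bool" where
  "quasi_isometric_embedding A dA dC f \<longleftrightarrow>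
     (\<exists>L\<ge>1. \<exists>C\<ge>0. \<forall>a\<in>A. \<forall>b\<in>A.
        dA a b / L - C \<le> dC (f a) (f b) \<and> dC (f a) (f b) \<le> L * dA a b + C)"

definition qi_embedded_by_action ::
    "('g, 'b) monoid_scheme \<Rightarrow> 'x set \<Rightarrow> ('x \<Rightarrow> 'x \<Rightarrow> real) \<Rightarrow> ('g \<Rightarrow> 'x \<Rightarrow> 'x) \<Rightarrow> 'g set \<Rightarrow> bool"
  where
  "qi_embedded_by_action G X d \<phi> H \<longleftrightarrow> subgroup H G \<and>
     (\<exists>S. finite_generating_set G H S \<and>
        (\<exists>x\<in>X. quasi_isometric_embedding H (word_dist G S) d (\<lambda>h. \<phi> h x)))"

definition qi_embedded_subgroup ::
    "('g, 'b) monoid_scheme \<Rightarrow> 'g set \<Rightarrow> 'g set \<Rightarrow> bool" where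
  "qi_embedded_subgroup G K H \<longleftrightarrow> subgroup K G \<and> subgroup H G \<and> K \<subseteq> H \<and>
     (\<exists>S T. finite_generating_set G K S \<and> finite_generating_set G H T \<and>
        quasi_isometric_embedding K (word_dist G S) (word_dist G T) (\<lambda>g. g))"

definition AQI_triple ::
    "('g, 'b) monoid_scheme \<Rightarrow> 'x set \<Rightarrow> ('x \<Rightarrow> 'x \<Rightarrow> real) \<Rightarrow> ('g \<Rightarrow> 'x \<Rightarrow> 'x) \<Rightarrow> 'g set \<Rightarrow> bool"
  where
  "AQI_triple G X d \<phi> H \<longleftrightarrow>
     hyperbolic_space X d \<and> isometric_action G X d \<phi> \<and>
     subgroup H G \<and> (\<exists>S. finite_generating_set G H S) \<and> infinite H \<and>
     acylindrical_along_subgroup G X d \<phi> H \<and> qi_embedded_by_action G X d \<phi> H"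

section \<open>Free products\<close>

text \<open>The free product of the groups \<open>Gs i\<close>, \<open>i \<in> I\<close>: words in the disjoint union of the groups,
  modulo the congruence generated by deleting identity letters and multiplying adjacent letters
  from the same factor.\<close>

definition fp_words :: "'i set \<Rightarrow> ('i \<Rightarrow> ('a, 'b) monoid_scheme) \<Rightarrow> ('i \<times> 'a) list set" where
  "fp_words I Gs = lists (SIGMA i:I. carrier (Gs i))"

inductive_set fp_rel ::
    "'i set \<Rightarrow> ('i \<Rightarrow> ('a, 'b) monoid_scheme) \<Rightarrow> (('i \<times> 'a) list \<times> ('i \<times> 'a) list) set"
  for I :: "'i set" and Gs :: "'i \<Rightarrow> ('a, 'b) monoid_scheme"
where
  fp_refl: "u \<in> fp_words I Gs \<Longrightarrow> (u, u) \<in> fp_rel I Gs"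
| fp_sym: "(u, v) \<in> fp_rel I Gs \<Longrightarrow> (v, u) \<in> fp_rel I Gs"
| fp_trans: "(u, v) \<in> fp_rel I Gs \<Longrightarrow> (v, w) \<in> fp_rel I Gs \<Longrightarrow> (u, w) \<in> fp_rel I Gs"
| fp_one: "u \<in> fp_words I Gs \<Longrightarrow> v \<in> fp_words I Gs \<Longrightarrow> i \<in> I \<Longrightarrow>
    (u @ [(i, \<one>\<^bsub>Gs i\<^esub>)] @ v, u @ v) \<in> fp_rel I Gs"
| fp_mult: "u \<in> fp_words I Gs \<Longrightarrow> v \<in> fp_words I Gs \<Longrightarrow> i \<in> I \<Longrightarrow>
    a \<in> carrier (Gs i) \<Longrightarrow> b \<in> carrier (Gs i) \<Longrightarrow>
    (u @ [(i, a), (i, b)] @ v, u @ [(i, a \<otimes>\<^bsub>Gs i\<^esub> b)] @ v) \<in> fp_rel I Gs"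

definition free_product ::
    "'i set \<Rightarrow> ('i \<Rightarrow> ('a, 'b) monoid_scheme) \<Rightarrow> ('i \<times> 'a) list set monoid" where
  "free_product I Gs =
     \<lparr>carrier = fp_words I Gs // fp_rel I Gs,
      mult = (\<lambda>A B. \<Union>u\<in>A. \<Union>v\<in>B. fp_rel I Gs `` {u @ v}),
      one = fp_rel I Gs `` {[]}\<rparr>"

text \<open>The homomorphism to \<open>G\<close> induced by the inclusions, when the factors are subgroups of \<open>G\<close>;
  word evaluation is constant on each class.\<close>
definition free_product_map ::
    "('a, 'b) monoid_scheme \<Rightarrow> ('i \<times> 'a) list set \<Rightarrow> 'a" where
  "free_product_map G A = the_elem ((\<lambda>w. word_prod G (map snd w)) ` A)"

lemma fp_rel_words:
  assumes "\<And>i. i \<in> I \<Longrightarrow> group (Gs i)" and "(u, v) \<in> fp_rel I Gs"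
  shows "u \<in> fp_words I Gs \<and> v \<in> fp_words I Gs"
  using assms(2)
proof (induction rule: fp_rel.induct)
  case (fp_one u v i)
  then show ?case
    using group.is_monoid[OF assms(1)] by (auto simp: fp_words_def monoid.one_closed)
next
  case (fp_mult u v i a b)
  then show ?case
    using group.is_monoid[OF assms(1)] by (auto simp: fp_words_def monoid.m_closed)
qed auto

lemma equiv_fp_rel:
  assumes "\<And>i. i \<in> I \<Longrightarrow> group (Gs i)"
  shows "equiv (fp_words I Gs) (fp_rel I Gs)"
proof (rule equivI)
  show "fp_rel I Gs \<subseteq> fp_words I Gs \<times> fp_words I Gs"
    using fp_rel_words[of I Gs, OF assms] by auto
  show "refl_on (fp_words I Gs) (fp_rel I Gs)"
    by (rule refl_onI) (rule fp_refl)
  show "sym (fp_rel I Gs)"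
    by (rule symI) (rule fp_sym)
  show "trans (fp_rel I Gs)"
    by (rule transI) (rule fp_trans)
qed

lemma fp_rel_append_left:
  assumes "w \<in> fp_words I Gs" and "(u, v) \<in> fp_rel I Gs"
  shows "(w @ u, w @ v) \<in> fp_rel I Gs"
  using assms(2)
proof (induction rule: fp_rel.induct)
  case (fp_one u v i)
  then show ?case
    using fp_rel.fp_one[of "w @ u" I Gs v i] assms(1) by (simp add: fp_words_def)
next
  case (fp_mult u v i a b)
  then show ?case
    using fp_rel.fp_mult[of "w @ u" I Gs v i a b] assms(1) by (simp add: fp_words_def)
next
  case (fp_refl u)
  then show ?case
    using fp_rel.fp_refl[of "w @ u" I Gs] assms(1) by (simp add: fp_words_def)
next
  case (fp_sym u v)
  show ?case by (rule fp_rel.fp_sym[OF fp_sym.IH])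
next
  case (fp_trans u v w)
  show ?case by (rule fp_rel.fp_trans[OF fp_trans.IH])
qed

lemma fp_rel_append_right:
  assumes "w \<in> fp_words I Gs" and "(u, v) \<in> fp_rel I Gs"
  shows "(u @ w, v @ w) \<in> fp_rel I Gs"
  using assms(2)
proof (induction rule: fp_rel.induct)
  case (fp_one u v i)
  then show ?case
    using fp_rel.fp_one[of u I Gs "v @ w" i] assms(1) by (simp add: fp_words_def)
next
  case (fp_mult u v i a b)
  then show ?case
    using fp_rel.fp_mult[of u I Gs "v @ w" i a b] assms(1) by (simp add: fp_words_def)
next
  case (fp_refl u)
  then show ?case
    using fp_rel.fp_refl[of "u @ w" I Gs] assms(1) by (simp add: fp_words_def)
next
  case (fp_sym u v)
  show ?case by (rule fp_rel.fp_sym[OF fp_sym.IH])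
next
  case (fp_trans u v w)
  show ?case by (rule fp_rel.fp_trans[OF fp_trans.IH])
qed

lemma fp_rel_append:
  assumes "\<And>i. i \<in> I \<Longrightarrow> group (Gs i)"
    and "(u, u') \<in> fp_rel I Gs" and "(v, v') \<in> fp_rel I Gs"
  shows "(u @ v, u' @ v') \<in> fp_rel I Gs"
proof (rule fp_trans)
  show "(u @ v, u' @ v) \<in> fp_rel I Gs"
    using fp_rel_append_right fp_rel_words[of I Gs, OF assms(1,3)] assms(2) by blast
  show "(u' @ v, u' @ v') \<in> fp_rel I Gs"
    using fp_rel_append_left fp_rel_words[of I Gs, OF assms(1,2)] assms(3) by blast
qed

lemma free_product_mult:
  assumes g: "\<And>i. i \<in> I \<Longrightarrow> group (Gs i)"
    and u: "u \<in> fp_words I Gs" and v: "v \<in> fp_words I Gs"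
  shows "(fp_rel I Gs `` {u}) \<otimes>\<^bsub>free_product I Gs\<^esub> (fp_rel I Gs `` {v})
           = fp_rel I Gs `` {u @ v}"
proof -
  have e: "equiv (fp_words I Gs) (fp_rel I Gs)"
    by (rule equiv_fp_rel[of I Gs, OF g])
  have 1: "fp_rel I Gs `` {u' @ v'} = fp_rel I Gs `` {u @ v}"
    if "(u, u') \<in> fp_rel I Gs" "(v, v') \<in> fp_rel I Gs" for u' v'
    using equiv_class_eq[OF e fp_rel_append[where I = I and Gs = Gs, OF g that]] by simp
  have 2: "(u, u) \<in> fp_rel I Gs" "(v, v) \<in> fp_rel I Gs"
    using u v by (simp_all add: fp_refl)
  have "(\<Union>u'\<in>fp_rel I Gs `` {u}. \<Union>v'\<in>fp_rel I Gs `` {v}. fp_rel I Gs `` {u' @ v'})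
      = (\<Union>u'\<in>fp_rel I Gs `` {u}. \<Union>v'\<in>fp_rel I Gs `` {v}. fp_rel I Gs `` {u @ v})"
    by (intro SUP_cong refl 1) simp_all
  also have "\<dots> = fp_rel I Gs `` {u @ v}"
    using 2 by blast
  finally show ?thesis
    by (simp add: free_product_def)
qed

lemma fp_left_inverse:
  assumes g: "\<And>i. i \<in> I \<Longrightarrow> group (Gs i)" and "w \<in> fp_words I Gs"
  shows "\<exists>w'\<in>fp_words I Gs. (w' @ w, []) \<in> fp_rel I Gs"
  using assms(2)
proof (induction w)
  case Nil
  then show ?case by (intro bexI[of _ "[]"]) (auto intro: fp_refl)
next
  case (Cons x w)
  obtain i a where x: "x = (i, a)" by (cases x)
  with Cons.prems have i: "i \<in> I" "a \<in> carrier (Gs i)" "w \<in> fp_words I Gs"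
    by (auto simp: fp_words_def)
  then obtain w' where w': "w' \<in> fp_words I Gs" "(w' @ w, []) \<in> fp_rel I Gs"
    using Cons.IH by blast
  interpret group "Gs i" using g i by blast
  let ?b = "inv\<^bsub>Gs i\<^esub> a"
  have "(w' @ [(i, ?b), (i, a)] @ w, w' @ [(i, \<one>\<^bsub>Gs i\<^esub>)] @ w) \<in> fp_rel I Gs"
    using fp_rel.fp_mult[of w' I Gs w i ?b a] i w' by simp
  moreover have "(w' @ [(i, \<one>\<^bsub>Gs i\<^esub>)] @ w, w' @ w) \<in> fp_rel I Gs"
    using fp_rel.fp_one[of w' I Gs w i] i w' by blast
  ultimately have "((w' @ [(i, ?b)]) @ x # w, []) \<in> fp_rel I Gs"
    using fp_rel.fp_trans[OF fp_rel.fp_trans w'(2)] x by simp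
  moreover have "w' @ [(i, ?b)] \<in> fp_words I Gs"
    using w'(1) i by (auto simp: fp_words_def)
  ultimately show ?case by blast
qed

lemma group_free_product:
  assumes g: "\<And>i. i \<in> I \<Longrightarrow> group (Gs i)"
  shows "group (free_product I Gs)"
proof (rule groupI)
  note m = free_product_mult[where I = I and Gs = Gs, OF g]
  have c: "carrier (free_product I Gs) = fp_words I Gs // fp_rel I Gs"
    and o: "\<one>\<^bsub>free_product I Gs\<^esub> = fp_rel I Gs `` {[]}"
    by (auto simp: free_product_def)
  have app: "u @ v \<in> fp_words I Gs" if "u \<in> fp_words I Gs" "v \<in> fp_words I Gs" for u v
    using that by (auto simp: fp_words_def)
  have nil: "[] \<in> fp_words I Gs"
    by (simp add: fp_words_def)
  fix x y
  assume x: "x \<in> carrier (free_product I Gs)"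
  then obtain u where u: "u \<in> fp_words I Gs" "x = fp_rel I Gs `` {u}"
    unfolding c by (auto elim: quotientE)
  show "\<one>\<^bsub>free_product I Gs\<^esub> \<otimes>\<^bsub>free_product I Gs\<^esub> x = x"
    unfolding o u(2) using m[OF _ nil u(1)] by simp
  obtain u' where u': "u' \<in> fp_words I Gs" "(u' @ u, []) \<in> fp_rel I Gs"
    using fp_left_inverse[where I = I and Gs = Gs, OF g u(1)] by blast
  have "fp_rel I Gs `` {u'} \<in> carrier (free_product I Gs)"
    unfolding c using u'(1) by (rule quotientI)
  moreover have "fp_rel I Gs `` {u'} \<otimes>\<^bsub>free_product I Gs\<^esub> x = \<one>\<^bsub>free_product I Gs\<^esub>"
    unfolding o u(2) using m[OF _ u'(1) u(1)] equiv_class_eq[OF equiv_fp_rel[of I Gs, OF g] u'(2)] by simp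
  ultimately show "\<exists>y\<in>carrier (free_product I Gs).
      y \<otimes>\<^bsub>free_product I Gs\<^esub> x = \<one>\<^bsub>free_product I Gs\<^esub>" by blast
  assume y: "y \<in> carrier (free_product I Gs)"
  then obtain v where v: "v \<in> fp_words I Gs" "y = fp_rel I Gs `` {v}"
    unfolding c by (auto elim: quotientE)
  show "x \<otimes>\<^bsub>free_product I Gs\<^esub> y \<in> carrier (free_product I Gs)"
    unfolding u(2) v(2) using m[OF _ u(1) v(1)] app[OF u(1) v(1)] c by (simp add: quotientI)
  fix z
  assume "z \<in> carrier (free_product I Gs)"
  then obtain w where w: "w \<in> fp_words I Gs" "z = fp_rel I Gs `` {w}"
    unfolding c by (auto elim: quotientE)
  show "x \<otimes>\<^bsub>free_product I Gs\<^esub> y \<otimes>\<^bsub>free_product I Gs\<^esub> z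
      = x \<otimes>\<^bsub>free_product I Gs\<^esub> (y \<otimes>\<^bsub>free_product I Gs\<^esub> z)"
    unfolding u(2) v(2) w(2)
    by (simp add: m u(1) v(1) w(1) app g)
next
  show "\<one>\<^bsub>free_product I Gs\<^esub> \<in> carrier (free_product I Gs)"
    by (auto simp: free_product_def fp_words_def intro: quotientI)
qed

lemma free_product_map_class:
  assumes G: "group G" and s: "\<And>i. i \<in> I \<Longrightarrow> subgroup (K i) G"
    and w: "w \<in> fp_words I (\<lambda>i. G\<lparr>carrier := K i\<rparr>)"
  shows "free_product_map G (fp_rel I (\<lambda>i. G\<lparr>carrier := K i\<rparr>) `` {w}) = word_prod G (map snd w)"
proof -
  interpret group G by (rule G)
  let ?Gs = "\<lambda>i. G\<lparr>carrier := K i\<rparr>"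
  have Kc: "a \<in> carrier G" if "i \<in> I" "a \<in> K i" for i a
    using subgroup.mem_carrier[OF s] that by blast
  have Cw: "(i, a) # u \<in> fp_words I ?Gs \<longleftrightarrow> i \<in> I \<and> a \<in> K i \<and> u \<in> fp_words I ?Gs" for i a u
    by (simp add: fp_words_def)
  have wp: "word_prod G [] = \<one>\<^bsub>G\<^esub>" "word_prod G (a # as) = a \<otimes>\<^bsub>G\<^esub> word_prod G as" for a as
    by (simp_all add: word_prod_def)
  have closed: "word_prod G (map snd u) \<in> carrier G" if "u \<in> fp_words I ?Gs" for u
    using that
  proof (induction u)
    case (Cons x u)
    obtain i a where x: "x = (i, a)" by (cases x)
    with Cons show ?case
      using Kc[of i a] by (simp add: x wp Cw)
  qed (simp add: wp)
  have app: "word_prod G (map snd (u @ v)) = word_prod G (map snd u) \<otimes>\<^bsub>G\<^esub> word_prod G (map snd v)"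
    if "u \<in> fp_words I ?Gs" "v \<in> fp_words I ?Gs" for u v
    using that(1)
  proof (induction u)
    case Nil
    then show ?case using closed[OF that(2)] by (simp add: wp)
  next
    case (Cons x u)
    obtain i a where x: "x = (i, a)" by (cases x)
    with Cons.prems have "i \<in> I" "a \<in> K i" "u \<in> fp_words I ?Gs"
      by (simp_all add: Cw)
    then show ?case
      using Cons.IH closed[of u] closed[OF that(2)] Kc[of i a] by (simp add: x wp m_assoc)
  qed
  have eval: "word_prod G (map snd u) = word_prod G (map snd v)" if "(u, v) \<in> fp_rel I ?Gs" for u v
    using that
  proof (induction rule: fp_rel.induct)
    case (fp_one u v i)
    have "(i, \<one>\<^bsub>G\<^esub>) # v \<in> fp_words I ?Gs"
      using fp_one subgroup.one_closed[OF s] by (simp add: Cw)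
    from app[OF fp_one(1) this] app[OF fp_one(1,2)] show ?case
      using closed[OF fp_one(2)] by (simp add: wp)
  next
    case (fp_mult u v i a b)
    then have K: "a \<in> K i" "b \<in> K i" by simp_all
    then have ab: "a \<in> carrier G" "b \<in> carrier G"
      using Kc[OF fp_mult(3)] by simp_all
    have "(i, a) # (i, b) # v \<in> fp_words I ?Gs" "(i, a \<otimes>\<^bsub>G\<^esub> b) # v \<in> fp_words I ?Gs"
      using fp_mult(2,3) K subgroup.m_closed[OF s] by (simp_all add: Cw)
    from app[OF fp_mult(1) this(1)] app[OF fp_mult(1) this(2)] show ?case
      using closed[OF fp_mult(2)] ab by (simp add: wp m_assoc)
  qed auto
  have "(\<lambda>u. word_prod G (map snd u)) ` (fp_rel I ?Gs `` {w}) = {word_prod G (map snd w)}"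
  proof (intro equalityI subsetI)
    fix y
    assume "y \<in> (\<lambda>u. word_prod G (map snd u)) ` (fp_rel I ?Gs `` {w})"
    then obtain u where "(w, u) \<in> fp_rel I ?Gs" "y = word_prod G (map snd u)" by auto
    then show "y \<in> {word_prod G (map snd w)}" using eval[of w u] by simp
  qed (use fp_refl[OF w] in auto)
  then show ?thesis
    by (simp add: free_product_map_def)
qed

end

theory Submission
  imports Defs "HOL-Library.Diagonal_Subsequence" "HOL-Real_Asymp.Real_Asymp"
begin

text \<open>Write an element of the subgroup generated by the \<open>K\<^sub>i\<close> as a reduced word \<open>k\<^sub>1 \<dots> k\<^sub>n\<close> and join the points
  \<open>p\<^sub>j = k\<^sub>1 \<dots> k\<^sub>j x\<^sub>0\<close>. Disjointness of the limit sets bounds the Gromov products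
  \<open>(h x\<^sub>0 | h' x\<^sub>0)\<close> for \<open>h\<close>, \<open>h'\<close> in different \<open>H\<^sub>i\<close> by a constant \<open>C\<close>, so the path bends little at each
  \<open>p\<^sub>j\<close>. If the \<open>K\<^sub>i\<close> avoid the finitely many elements of small displacement, the segments are long
  compared with \<open>C\<close> and \<open>\<delta>\<close>, and such a path is a quasi-geodesic passing near the geodesic between its
  endpoints; this gives freeness and the quasi-isometric embedding.

  For acylindricity, let \<open>g\<close> move both endpoints by at most \<open>\<epsilon>\<close>. If some segment is very long
  in terms of \<open>\<epsilon>\<close>, acylindricity along the corresponding \<open>H\<^sub>i\<close> bounds the number of such \<open>g\<close>.
  Otherwise some segment lies far from both endpoints; along it \<open>g\<close> acts almost as a translation by
  at most \<open>\<epsilon>\<close>, so up to a number of translation lengths depending only on \<open>\<epsilon>\<close> the \<open>g\<close> differ by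
  elements moving the segment by a constant depending on \<open>C\<close> and \<open>\<delta>\<close> only. Acylindricity at that
  one constant controls these once the finite set of excluded elements is chosen large enough.\<close>

section \<open>Gromov products\<close>

locale gromov_hyperbolic_metric = Metric_space X d for X :: "'x set" and d +
  fixes \<delta> :: real
  assumes delta_nonneg: "0 \<le> \<delta>"
    and hyp: "\<lbrakk>w \<in> X; x \<in> X; y \<in> X; z \<in> X\<rbrakk> \<Longrightarrow>
      min (gromov_product d w x y) (gromov_product d w y z) - \<delta> \<le> gromov_product d w x z"
begin

abbreviation gp where "gp \<equiv> gromov_product d"

lemma gp_commute: "gp w x y = gp w y x"
  by (simp add: gromov_product_def commute)

lemma gp_self: "x \<in> X \<Longrightarrow> gp w x x = d x w"
  by (simp add: gromov_product_def)

lemma gp_le_dist: "\<lbrakk>w \<in> X; x \<in> X; y \<in> X\<rbrakk> \<Longrightarrow> gp w x y \<le> d x w"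
  using triangle[of y x w] by (simp add: gromov_product_def commute)

lemma gp_ge: "\<lbrakk>w \<in> X; x \<in> X; y \<in> X\<rbrakk> \<Longrightarrow> d x w - d x y \<le> gp w x y"
  using triangle[of x y w] by (simp add: gromov_product_def commute)

lemma gp_sum: "\<lbrakk>w \<in> X; x \<in> X; y \<in> X\<rbrakk> \<Longrightarrow> gp w x y + gp x w y = d w x"
  by (simp add: gromov_product_def commute field_simps)

lemma gp_left: "\<lbrakk>w \<in> X; y \<in> X\<rbrakk> \<Longrightarrow> gp w w y = 0"
  by (simp add: gromov_product_def commute)

lemma gp_right: "\<lbrakk>w \<in> X; y \<in> X\<rbrakk> \<Longrightarrow> gp w y w = 0"
  by (simp add: gromov_product_def commute)

text \<open>This is \<open>hyp\<close> at base point \<open>p\<close> with the common terms of the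
  Gromov products cancelled; in this form no base point is singled out.\<close>

lemma four_point:
  assumes "p \<in> X" "q \<in> X" "x \<in> X" "y \<in> X"
  shows "d p q + d x y \<le> max (d p x + d q y) (d p y + d q x) + 2 * \<delta>"
  using hyp[of p x q y] assms by (simp add: gromov_product_def commute min_def max_def field_simps split: if_splits)

text \<open>A bound on \<open>gp p x y\<close> says that \<open>p\<close> lies near a geodesic from
  \<open>x\<close> to \<open>y\<close>. Up to a bounded error such a point is determined by its
  distance to \<open>x\<close>, and \<open>four_point\<close> makes the error explicit.\<close>

lemma dist_le_of_gp_le:
  assumes X: "p \<in> X" "q \<in> X" "x \<in> X" "y \<in> X" and c: "gp p x y \<le> c" "gp q x y \<le> c"
  shows "d p q \<le> \<bar>d x p - d x q\<bar> + 2 * c + 2 * \<delta>"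
  using four_point[OF X] c by (simp add: gromov_product_def commute max_def field_simps split: if_splits)

text \<open>The chain is bisected rather than followed link by link: each level of bisection costs
  one \<delta>, so the loss is logarithmic in the number of links.\<close>

lemma gp_chain:
  assumes "\<And>i. i \<le> l \<Longrightarrow> q i \<in> X" "w \<in> X" "1 \<le> l" "l \<le> 2 ^ k"
    and "\<And>i. i < l \<Longrightarrow> r \<le> gp w (q i) (q (Suc i))"
  shows "r - k * \<delta> \<le> gp w (q 0) (q l)"
  using assms
proof (induction k arbitrary: l q)
  case 0
  then show ?case by simp
next
  case (Suc k)
  show ?case
  proof (cases "l \<le> 2 ^ k")
    case True
    have "r - k * \<delta> \<le> gp w (q 0) (q l)"
      using Suc.IH[of l q] Suc.prems True by simp
    then show ?thesis using delta_nonneg by (simp add: algebra_simps)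
  next
    case False
    have "r - k * \<delta> \<le> gp w (q 0) (q (2 ^ k))"
      using Suc.IH[of "2 ^ k" q] Suc.prems False by simp
    moreover have "r - k * \<delta> \<le> gp w (q (2 ^ k + 0)) (q (2 ^ k + (l - 2 ^ k)))"
      using Suc.IH[of "l - 2 ^ k" "\<lambda>i. q (2 ^ k + i)"] Suc.prems False by simp
    moreover have "min (gp w (q 0) (q (2 ^ k))) (gp w (q (2 ^ k)) (q l)) - \<delta> \<le> gp w (q 0) (q l)"
      using False Suc.prems by (intro hyp) auto
    ultimately show ?thesis using False by (simp add: algebra_simps)
  qed
qed

text \<open>The points with index in \<open>[2^s, 2^{s+1}]\<close> lie outside a ball whose radius grows linearly in
  \<open>2^s\<close>, whereas chaining them costs only \<open>s\<delta>\<close>. This replaces the stability of quasi-geodesics.\<close>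
lemma gp_quasi_geodesic:
  assumes "w \<in> X" "0 < L" and a: "\<And>m. m \<le> n \<Longrightarrow> a m \<in> X"
    and far: "\<And>m. m \<le> n \<Longrightarrow> m / L - B \<le> d (a m) w"
    and step: "\<And>m. m < n \<Longrightarrow> d (a m) (a (Suc m)) \<le> D" and "0 \<le> D"
    and "2 * \<delta> * L \<le> 2 ^ s" "2 ^ s \<le> n"
  shows "2 ^ s / L - B - D - (s + 1) * \<delta> \<le> gp w (a (2 ^ s)) (a n)"
proof -
  \<comment> \<open>Inside one dyadic block every point is at least \<open>2 ^ s / L - B\<close>
    away from \<open>w\<close> and consecutive points are at most \<open>D\<close> apart, so
    \<open>gp_ge\<close> bounds each link and \<open>gp_chain\<close> applies.\<close>
  have block: "2 ^ s / L - B - D - s * \<delta> \<le> gp w (a (2 ^ s)) (a m)"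
    if "m \<le> n" "2 ^ s \<le> m" "m \<le> 2 ^ Suc s" for s m
  proof (cases "m = 2 ^ s")
    case True
    have "2 ^ s / L - B \<le> gp w (a m) (a m)"
      using far[of m] a[of m] that True by (simp add: gp_self)
    then show ?thesis
      using True \<open>0 \<le> D\<close> delta_nonneg by (smt (verit, best) mult_nonneg_nonneg of_nat_0_le_iff)
  next
    case False
    have "2 ^ s / L - B - D - s * \<delta> \<le> gp w (a (2 ^ s + 0)) (a (2 ^ s + (m - 2 ^ s)))"
    proof (rule gp_chain[where q = "\<lambda>i. a (2 ^ s + i)"])
      fix i
      assume "i < m - 2 ^ s"
      then have i: "2 ^ s + i < n" using that by linarith
      have "2 ^ s / L - B \<le> (2 ^ s + i) / L - B"
        using \<open>0 < L\<close> by (simp add: divide_right_mono)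
      also have "\<dots> \<le> d (a (2 ^ s + i)) w"
        using far[of "2 ^ s + i"] i by simp
      finally have "2 ^ s / L - B \<le> d (a (2 ^ s + i)) w" .
      then show "2 ^ s / L - B - D \<le> gp w (a (2 ^ s + i)) (a (2 ^ s + Suc i))"
        using gp_ge[of w "a (2 ^ s + i)" "a (Suc (2 ^ s + i))"] step[OF i] a i \<open>w \<in> X\<close>
        by simp
    qed (use a that \<open>w \<in> X\<close> False in auto)
    then show ?thesis using that by simp
  qed
  have "2 ^ s / L - B - D - (s + 1) * \<delta> \<le> gp w (a (2 ^ s)) (a n)"
    if "2 * \<delta> * L \<le> 2 ^ s" "2 ^ s \<le> n" "n \<le> 2 ^ (s + Suc k)" for s k
    using that
  proof (induction k arbitrary: s)
    case 0
    then show ?case using block[of n s] delta_nonneg by (simp add: algebra_simps)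
  next
    case (Suc k)
    show ?case
    proof (cases "n \<le> 2 ^ Suc s")
      case True
      then show ?thesis using block[of n s] Suc.prems delta_nonneg by (simp add: algebra_simps)
    next
      case False
      \<comment> \<open>Going from \<open>s\<close> to \<open>Suc s\<close> gains
        \<open>2 ^ s / L\<close> in the main term. This pays for the 2\<delta> by which the error of
        the later blocks exceeds \<open>s * \<delta>\<close>, so only the \<delta> of the final
        \<open>hyp\<close> remains.\<close>
      have "2 * \<delta> \<le> 2 ^ s / L"
        using Suc.prems(1) \<open>0 < L\<close> by (simp add: field_simps)
      moreover have "2 * \<delta> * L \<le> 2 ^ Suc s"
        using Suc.prems(1) power_increasing[of s "Suc s" "2 :: real"] by linarith
      then have "2 ^ Suc s / L - B - D - (Suc s + 1) * \<delta> \<le> gp w (a (2 ^ Suc s)) (a n)"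
        using Suc.IH[of "Suc s"] Suc.prems False by (simp del: power_Suc)
      ultimately have "2 ^ s / L - B - D - s * \<delta> \<le> gp w (a (2 ^ Suc s)) (a n)"
        by (simp add: algebra_simps)
      moreover have "2 ^ s / L - B - D - s * \<delta> \<le> gp w (a (2 ^ s)) (a (2 ^ Suc s))"
        using block[of "2 ^ Suc s" s] False by simp
      moreover have "min (gp w (a (2 ^ s)) (a (2 ^ Suc s))) (gp w (a (2 ^ Suc s)) (a n)) - \<delta>
          \<le> gp w (a (2 ^ s)) (a n)"
        using a \<open>w \<in> X\<close> Suc.prems False by (intro hyp) auto
      ultimately show ?thesis by (simp add: algebra_simps)
    qed
  qed
  moreover have "n \<le> 2 ^ (s + Suc n)"
    using less_exp[of "s + Suc n"] by linarith
  ultimately show ?thesis using assms by blast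
qed

end

section \<open>Broken geodesics with long segments and small Gromov products at the corners\<close>

locale broken_geodesic = gromov_hyperbolic_metric +
  fixes p :: "nat \<Rightarrow> 'a" and n :: nat and C :: real
  assumes C_nonneg: "0 \<le> C"
    and p_in: "j \<le> n \<Longrightarrow> p j \<in> X"
    and long: "j < n \<Longrightarrow> 2 * C + 3 * \<delta> < d (p j) (p (Suc j))"
    and angle: "Suc j < n \<Longrightarrow> gp (p (Suc j)) (p j) (p (Suc (Suc j))) \<le> C"
begin

text \<open>Because the segment is long, the bound at \<open>p m\<close> forces \<open>p 0\<close>
  and \<open>p m\<close> to lie in almost the same direction from \<open>p (Suc m)\<close>. The
  corner bound \<open>angle\<close> therefore passes from \<open>p m\<close> to \<open>p 0\<close>
  at the cost of one \<delta>, and the cost does not accumulate since \<open>angle\<close> is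
  applied anew at every corner.\<close>

lemma gp_end: "m < n \<Longrightarrow> gp (p m) (p 0) (p (Suc m)) \<le> C + \<delta>"
proof (induction m)
  case 0
  then show ?case using p_in C_nonneg delta_nonneg by (simp add: gp_left)
next
  case (Suc m)
  have X: "p 0 \<in> X" "p m \<in> X" "p (Suc m) \<in> X" "p (Suc (Suc m)) \<in> X"
    using p_in Suc.prems by auto
  have "gp (p m) (p 0) (p (Suc m)) \<le> C + \<delta>" using Suc by simp
  then have "C + \<delta> < gp (p (Suc m)) (p m) (p 0)"
    using gp_sum[of "p m" "p (Suc m)" "p 0"] long[of m] X Suc.prems delta_nonneg
    by (simp add: gp_commute)
  then show ?case
    using hyp[of "p (Suc m)" "p m" "p 0" "p (Suc (Suc m))"] X angle[of m] Suc.prems by simp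
qed

text \<open>By \<open>gp_end\<close> each further segment adds its length, less at most twice C +
  \<delta>, to the distance from \<open>p 0\<close>.\<close>

lemma dist_ge_sum:
  "m \<le> n \<Longrightarrow> (\<Sum>j<m. d (p j) (p (Suc j)) - 2 * C - 2 * \<delta>) \<le> d (p 0) (p m)"
proof (induction m)
  case (Suc m)
  then show ?case using gp_end[of m] by (simp add: gromov_product_def commute)
qed simp

lemma dist_start_mono: "m < n \<Longrightarrow> d (p 0) (p m) \<le> d (p 0) (p (Suc m))"
  using gp_end[of m] long[of m] delta_nonneg by (simp add: gromov_product_def commute)

lemma gp_middle:
  assumes "j \<le> n"
  shows "gp (p j) (p 0) (p n) \<le> C + 2 * \<delta>"
proof (cases "j = 0 \<or> j = n")
  case True
  then show ?thesis using p_in C_nonneg delta_nonneg by (auto simp: gp_left gp_right)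
next
  case False
  then obtain i where j: "j = Suc i" "j < n" using assms by (cases j) auto
  \<comment> \<open>The path run backwards from \<open>p n\<close> to \<open>p i\<close> satisfies
    the same assumptions, and its \<open>gp_end\<close> bounds the product of \<open>p i\<close> and
    \<open>p n\<close> at \<open>p j\<close>. The 3\<delta> in \<open>long\<close> makes the product
    of \<open>p i\<close> and \<open>p 0\<close> at \<open>p j\<close> exceed C + 2\<delta>, so
    \<open>hyp\<close> yields the claim.\<close>
  interpret rev: broken_geodesic X d \<delta> "\<lambda>k. p (n - k)" "n - i" C
  proof
    fix k
    assume k: "k < n - i"
    then have "Suc (n - Suc k) = n - k" by simp
    then show "2 * C + 3 * \<delta> < d (p (n - k)) (p (n - Suc k))"
      using long[of "n - Suc k"] k by (simp add: commute)
  next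
    fix k
    assume k: "Suc k < n - i"
    then have "Suc (n - Suc (Suc k)) = n - Suc k" "Suc (n - Suc k) = n - k" by auto
    then show "gp (p (n - Suc k)) (p (n - k)) (p (n - Suc (Suc k))) \<le> C"
      using angle[of "n - Suc (Suc k)"] k by (simp add: gp_commute)
  qed (use C_nonneg p_in in auto)
  have X: "p i \<in> X" "p j \<in> X" "p 0 \<in> X" "p n \<in> X" using p_in j by auto
  have "gp (p i) (p 0) (p j) \<le> C + \<delta>" using gp_end[of i] j by simp
  then have "C + 2 * \<delta> < gp (p j) (p i) (p 0)"
    using gp_sum[of "p i" "p j" "p 0"] long[of i] X j by (simp add: gp_commute)
  moreover have "gp (p j) (p i) (p n) \<le> C + \<delta>"
    using rev.gp_end[of "n - j"] j by (simp add: gp_commute Suc_diff_Suc)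
  ultimately show ?thesis
    using hyp[of "p j" "p i" "p 0" "p n"] X by simp
qed

end

section \<open>Word lengths\<close>

context group
begin

lemma word_prod_Nil [simp]: "word_prod G [] = \<one>"
  and word_prod_Cons [simp]: "word_prod G (a # as) = a \<otimes> word_prod G as"
  by (simp_all add: word_prod_def)

lemma word_prod_closed: "set gs \<subseteq> carrier G \<Longrightarrow> word_prod G gs \<in> carrier G"
  by (induction gs) auto

lemma word_prod_append:
  "set gs \<subseteq> carrier G \<Longrightarrow> set hs \<subseteq> carrier G \<Longrightarrow>
    word_prod G (gs @ hs) = word_prod G gs \<otimes> word_prod G hs"
  by (induction gs) (auto simp: word_prod_closed m_assoc)

lemma letters_in_carrier: "T \<subseteq> carrier G \<Longrightarrow> T \<union> m_inv G ` T \<subseteq> carrier G"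
  by auto

lemma letters_in_generate: "T \<union> m_inv G ` T \<subseteq> generate G T"
  by (auto intro: generate.incl generate.inv)

lemma word_prod_in_generate: "set gs \<subseteq> generate G T \<Longrightarrow> word_prod G gs \<in> generate G T"
  by (induction gs) (auto intro: generate.one generate.eng)

lemma generate_imp_word:
  assumes "T \<subseteq> carrier G" "g \<in> generate G T"
  shows "\<exists>gs. set gs \<subseteq> T \<union> m_inv G ` T \<and> word_prod G gs = g"
  using assms(2)
proof (induction rule: generate.induct)
  case one
  then show ?case by (intro exI[of _ "[]"]) simp
next
  case (incl h)
  then show ?case using assms(1) by (intro exI[of _ "[h]"]) auto
next
  case (inv h)
  then show ?case using assms(1) by (intro exI[of _ "[inv h]"]) auto
next
  case (eng g h)
  then obtain gs hs where
    "set gs \<subseteq> T \<union> m_inv G ` T" "word_prod G gs = g" "set hs \<subseteq> T \<union> m_inv G ` T" "word_prod G hs = h"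
    by blast
  moreover from this have "set gs \<subseteq> carrier G" "set hs \<subseteq> carrier G"
    using letters_in_carrier[OF assms(1)] by blast+
  ultimately show ?case
    by (intro exI[of _ "gs @ hs"]) (simp add: word_prod_append)
qed

lemma word_length_le: "set gs \<subseteq> T \<union> m_inv G ` T \<Longrightarrow> word_length G T (word_prod G gs) \<le> length gs"
  unfolding word_length_def by (rule Least_le) blast

lemma minimal_word:
  assumes "T \<subseteq> carrier G" "g \<in> generate G T"
  shows "\<exists>gs. length gs = word_length G T g \<and> set gs \<subseteq> T \<union> m_inv G ` T \<and> word_prod G gs = g"
  unfolding word_length_def
  by (rule LeastI_ex) (use generate_imp_word[OF assms] in blast)

lemma word_length_one [simp]: "word_length G T \<one> = 0"
  using word_length_le[of "[]" T] by simp

lemma word_length_mult: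
  assumes T: "T \<subseteq> carrier G" and "g \<in> generate G T" "h \<in> generate G T"
  shows "word_length G T (g \<otimes> h) \<le> word_length G T g + word_length G T h"
proof -
  obtain gs hs where
    "length gs = word_length G T g" "set gs \<subseteq> T \<union> m_inv G ` T" "word_prod G gs = g"
    "length hs = word_length G T h" "set hs \<subseteq> T \<union> m_inv G ` T" "word_prod G hs = h"
    using minimal_word[OF T assms(2)] minimal_word[OF T assms(3)] by blast
  moreover from this have "set gs \<subseteq> carrier G" "set hs \<subseteq> carrier G"
    using letters_in_carrier[OF T] by blast+
  ultimately show ?thesis
    using word_length_le[of "gs @ hs" T] by (simp add: word_prod_append)
qed

lemma word_length_antimono:
  assumes "S \<subseteq> T" "S \<subseteq> carrier G" "g \<in> generate G S"
  shows "word_length G T g \<le> word_length G S g"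
proof -
  obtain gs where "length gs = word_length G S g" "set gs \<subseteq> S \<union> m_inv G ` S" "word_prod G gs = g"
    using minimal_word[OF assms(2,3)] by blast
  then show ?thesis using word_length_le[of gs T] assms(1) by force
qed

text \<open>Applied twice: to word length over another generating set, and to the displacement of
  the base point.\<close>

lemma subadditive_le_word_length:
  fixes f :: "'a \<Rightarrow> real"
  assumes S: "S \<subseteq> carrier G" "g \<in> generate G S"
    and f: "f \<one> = 0" "\<And>a b. a \<in> generate G S \<Longrightarrow> b \<in> generate G S \<Longrightarrow> f (a \<otimes> b) \<le> f a + f b"
    and A: "\<And>s. s \<in> S \<union> m_inv G ` S \<Longrightarrow> f s \<le> A"
  shows "f g \<le> A * word_length G S g"
proof -
  have "f (word_prod G gs) \<le> A * length gs" if "set gs \<subseteq> S \<union> m_inv G ` S" for gs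
    using that
  proof (induction gs)
    case Nil
    then show ?case using f(1) by simp
  next
    case (Cons a gs)
    have "a \<in> generate G S" "word_prod G gs \<in> generate G S"
      using Cons.prems letters_in_generate[of S] by (auto intro!: word_prod_in_generate)
    then have "f (a \<otimes> word_prod G gs) \<le> f a + f (word_prod G gs)" by (rule f(2))
    also have "\<dots> \<le> A + A * length gs"
      using Cons A by (intro add_mono) auto
    finally show ?case by (simp add: algebra_simps)
  qed
  then show ?thesis using minimal_word[OF S] by metis
qed

lemma finite_letters_bound:
  fixes f :: "'a \<Rightarrow> real"
  assumes "finite S"
  obtains A where "0 \<le> A" "\<And>s. s \<in> S \<union> m_inv G ` S \<Longrightarrow> f s \<le> A"
proof
  \<comment> \<open>The inserted 0 keeps \<open>Max\<close> meaningful when \<open>S\<close> is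
    empty and makes the bound nonnegative.\<close>
  let ?F = "insert 0 (f ` (S \<union> m_inv G ` S))"
  have "finite ?F" using assms by simp
  then show "0 \<le> Max ?F" "\<And>s. s \<in> S \<union> m_inv G ` S \<Longrightarrow> f s \<le> Max ?F"
    by (auto intro!: Max_ge)
qed

lemma word_length_change_generators:
  assumes "finite S" "S \<subseteq> generate G T" "T \<subseteq> carrier G"
  shows "\<exists>A::real. 0 \<le> A \<and> (\<forall>g\<in>generate G S. word_length G T g \<le> A * word_length G S g)"
proof -
  obtain A :: real where A: "0 \<le> A" "\<And>s. s \<in> S \<union> m_inv G ` S \<Longrightarrow> word_length G T s \<le> A"
    using finite_letters_bound[OF assms(1), of "\<lambda>s. real (word_length G T s)"] by blast
  have S: "S \<subseteq> carrier G"
    using assms generate_incl by blast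
  have "generate G S \<subseteq> generate G T"
    by (rule generate_subgroup_incl[OF assms(2) generate_is_subgroup[OF assms(3)]])
  then have "real (word_length G T (a \<otimes> b)) \<le> word_length G T a + word_length G T b"
    if "a \<in> generate G S" "b \<in> generate G S" for a b
    using word_length_mult[OF assms(3), of a b] that by (simp add: subset_iff flip: of_nat_add)
  then have "word_length G T g \<le> A * word_length G S g" if "g \<in> generate G S" for g
    using A(2) by (intro subadditive_le_word_length[OF S that]) simp_all
  then show ?thesis using A(1) by blast
qed

lemma finite_word_ball:
  assumes "finite T" "T \<subseteq> carrier G"
  shows "finite {g \<in> generate G T. real (word_length G T g) \<le> r}"
proof (rule finite_subset)
  let ?W = "{gs. set gs \<subseteq> T \<union> m_inv G ` T \<and> length gs \<le> nat \<lfloor>r\<rfloor>}"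
  show "{g \<in> generate G T. real (word_length G T g) \<le> r} \<subseteq> word_prod G ` ?W"
  proof
    fix g
    assume g: "g \<in> {g \<in> generate G T. real (word_length G T g) \<le> r}"
    then obtain gs where
      "length gs = word_length G T g" "set gs \<subseteq> T \<union> m_inv G ` T" "word_prod G gs = g"
      using minimal_word[OF assms(2)] by blast
    with g show "g \<in> word_prod G ` ?W" by (auto simp: le_nat_floor)
  qed
  show "finite (word_prod G ` ?W)"
    using assms(1) by (intro finite_imageI finite_lists_length_le) simp
qed

text \<open>A shorter expression of a prefix, followed by the remaining letters, would be a shorter
  expression of the whole word.\<close>

lemma word_length_take:
  assumes T: "T \<subseteq> carrier G" and gs: "set gs \<subseteq> T \<union> m_inv G ` T"
    and min: "length gs = word_length G T (word_prod G gs)" and "m \<le> length gs"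
  shows "word_length G T (word_prod G (take m gs)) = m"
proof (rule antisym)
  have t: "set (take m gs) \<subseteq> T \<union> m_inv G ` T" "set (drop m gs) \<subseteq> T \<union> m_inv G ` T"
    using gs set_take_subset[of m gs] set_drop_subset[of m gs] by auto
  show "word_length G T (word_prod G (take m gs)) \<le> m"
    using word_length_le[OF t(1)] \<open>m \<le> length gs\<close> by simp
  have "word_prod G gs = word_prod G (take m gs) \<otimes> word_prod G (drop m gs)"
    using t letters_in_carrier[OF T] word_prod_append[of "take m gs" "drop m gs"] by auto
  moreover have "word_prod G (take m gs) \<in> generate G T" "word_prod G (drop m gs) \<in> generate G T"
    using t letters_in_generate[of T] by (blast intro: word_prod_in_generate)+
  ultimately have "length gs \<le> word_length G T (word_prod G (take m gs))
      + word_length G T (word_prod G (drop m gs))"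
    using word_length_mult[OF T] min by metis
  moreover have "word_length G T (word_prod G (drop m gs)) \<le> length gs - m"
    using word_length_le[OF t(2)] by simp
  ultimately show "m \<le> word_length G T (word_prod G (take m gs))"
    using \<open>m \<le> length gs\<close> by linarith
qed

end

section \<open>Quasi-isometrically embedded orbits\<close>

locale hyperbolic_action = gromov_hyperbolic_metric X d \<delta> + group G + action: group_action G X \<phi>
  for X :: "'x set" and d \<delta> and G :: "('g, 'b) monoid_scheme" (structure) and \<phi> +
  fixes x\<^sub>0
  assumes isometry: "\<lbrakk>g \<in> carrier G; x \<in> X; y \<in> X\<rbrakk> \<Longrightarrow> d (\<phi> g x) (\<phi> g y) = d x y"
    and base_in: "x\<^sub>0 \<in> X"
begin

abbreviation pt where "pt g \<equiv> \<phi> g x\<^sub>0"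

abbreviation disp where "disp g \<equiv> d x\<^sub>0 (pt g)"

lemma act_in: "g \<in> carrier G \<Longrightarrow> x \<in> X \<Longrightarrow> \<phi> g x \<in> X"
  using action.element_image by blast

lemma pt_in: "g \<in> carrier G \<Longrightarrow> pt g \<in> X"
  by (rule act_in[OF _ base_in])

lemma act_one: "x \<in> X \<Longrightarrow> \<phi> \<one> x = x"
  using action.id_eq_one by (metis restrict_apply')

lemma act_mult: "\<lbrakk>g \<in> carrier G; h \<in> carrier G; x \<in> X\<rbrakk> \<Longrightarrow> \<phi> (g \<otimes> h) x = \<phi> g (\<phi> h x)"
  by (rule action.composition_rule)

lemma dist_pt_mult: "\<lbrakk>g \<in> carrier G; h \<in> carrier G\<rbrakk> \<Longrightarrow> d (pt g) (pt (g \<otimes> h)) = disp h"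
  by (simp add: act_mult base_in isometry pt_in)

lemma gp_act:
  "\<lbrakk>g \<in> carrier G; w \<in> X; x \<in> X; y \<in> X\<rbrakk> \<Longrightarrow> gp (\<phi> g w) (\<phi> g x) (\<phi> g y) = gp w x y"
  by (simp add: gromov_product_def isometry)

lemma disp_one: "disp \<one> = 0"
  by (simp add: act_one base_in)

lemma disp_mult: "\<lbrakk>g \<in> carrier G; h \<in> carrier G\<rbrakk> \<Longrightarrow> disp (g \<otimes> h) \<le> disp g + disp h"
  using triangle[of x\<^sub>0 "pt g" "pt (g \<otimes> h)"] dist_pt_mult[of g h] by (simp add: pt_in base_in)

lemma disp_le_word_length:
  assumes "T \<subseteq> carrier G" "g \<in> generate G T"
    and "\<And>s. s \<in> T \<union> m_inv G ` T \<Longrightarrow> disp s \<le> A"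
  shows "disp g \<le> A * word_length G T g"
  using assms generate_in_carrier[OF assms(1)]
  by (intro subadditive_le_word_length) (auto simp: disp_one disp_mult)

text \<open>Only the lower bound of a quasi-isometric embedding is recorded, and only between the
  identity and \<open>h\<close>: left invariance reduces pairs to this case, and the upper bound
  comes from \<open>disp_le_word_length\<close>.\<close>

definition undistorted :: "'g set \<Rightarrow> real \<Rightarrow> real \<Rightarrow> bool" where
  "undistorted T L B \<longleftrightarrow> finite T \<and> T \<subseteq> carrier G \<and> 1 \<le> L \<and> 0 \<le> B \<and>
     (\<forall>h\<in>generate G T. word_length G T h \<le> L * disp h + B)"

text \<open>The embedding may be given at another base point \<open>x\<close>. Passing to
  \<open>x\<^sub>0\<close> changes displacements by at most \<open>2 * d x\<^sub>0 x\<close>, which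
  goes into the additive constant.\<close>

lemma qi_embedded_imp_undistorted:
  assumes "qi_embedded_by_action G X d \<phi> H"
  obtains T L B where "finite_generating_set G H T" "undistorted T L B"
proof -
  obtain T x where H: "subgroup H G" and T: "finite_generating_set G H T" and x: "x \<in> X"
    and "quasi_isometric_embedding H (word_dist G T) d (\<lambda>h. \<phi> h x)"
    using assms unfolding qi_embedded_by_action_def by blast
  then obtain L C where LC: "1 \<le> L" "0 \<le> C"
    and qi: "\<And>a b. a \<in> H \<Longrightarrow> b \<in> H \<Longrightarrow> word_dist G T a b / L - C \<le> d (\<phi> a x) (\<phi> b x)"
    unfolding quasi_isometric_embedding_def by metis
  have Hc: "H \<subseteq> carrier G" using H by (rule subgroup.subset)
  have "word_length G T h \<le> L * disp h + L * (C + 2 * d x\<^sub>0 x)" if h: "h \<in> H" for h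
  proof -
    have hc: "h \<in> carrier G" using h Hc by blast
    have "word_dist G T \<one> h / L - C \<le> d (\<phi> \<one> x) (\<phi> h x)"
      by (rule qi[OF subgroup.one_closed[OF H] h])
    then have "word_length G T h / L - C \<le> d x (\<phi> h x)"
      using hc x by (simp add: word_dist_def act_one)
    moreover have "d x (\<phi> h x) \<le> d x x\<^sub>0 + d x\<^sub>0 (\<phi> h x)"
      using x base_in act_in[OF hc x] by (intro triangle)
    moreover have "d x\<^sub>0 (\<phi> h x) \<le> disp h + d (pt h) (\<phi> h x)"
      using base_in pt_in[OF hc] act_in[OF hc x] by (intro triangle)
    moreover have "d (pt h) (\<phi> h x) = d x\<^sub>0 x" "d x x\<^sub>0 = d x\<^sub>0 x"
      using hc x base_in by (simp_all add: isometry commute)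
    ultimately have "word_length G T h / L \<le> disp h + (C + 2 * d x\<^sub>0 x)"
      by linarith
    then have "word_length G T h \<le> (disp h + (C + 2 * d x\<^sub>0 x)) * L"
      using LC by (simp only: pos_divide_le_eq)
    then show ?thesis by (simp add: algebra_simps)
  qed
  moreover have "0 \<le> L * (C + 2 * d x\<^sub>0 x)" using LC by simp
  moreover have "finite T" "T \<subseteq> carrier G" "generate G T = H"
    using T Hc by (auto simp: finite_generating_set_def)
  ultimately have "undistorted T L (L * (C + 2 * d x\<^sub>0 x))"
    unfolding undistorted_def using LC by blast
  with T show ?thesis using that by blast
qed

lemma undistorted_imp_qi_embedded:
  assumes "undistorted T L B"
  shows "qi_embedded_by_action G X d \<phi> (generate G T)"
proof -
  have T: "finite T" "T \<subseteq> carrier G" and LB: "1 \<le> L" "0 \<le> B"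
    and le: "\<And>h. h \<in> generate G T \<Longrightarrow> word_length G T h \<le> L * disp h + B"
    using assms by (auto simp: undistorted_def)
  obtain A where A: "0 \<le> A" "\<And>s. s \<in> T \<union> m_inv G ` T \<Longrightarrow> disp s \<le> A"
    using finite_letters_bound[OF T(1), of disp] by blast
  have K: "subgroup (generate G T) G" by (rule generate_is_subgroup[OF T(2)])
  have "quasi_isometric_embedding (generate G T) (word_dist G T) d pt"
    unfolding quasi_isometric_embedding_def
  proof (intro exI conjI ballI)
    \<comment> \<open>\<open>L\<close> serves the lower bound and \<open>A\<close>, a bound for the
      displacement of the letters, the upper one; the definition asks for a single constant, and the
      sum serves both.\<close>
    show "1 \<le> L + A" "0 \<le> B" using LB A by auto
    fix a b
    assume ab: "a \<in> generate G T" "b \<in> generate G T"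
    let ?h = "inv a \<otimes> b"
    have abc: "a \<in> carrier G" "b \<in> carrier G" using ab K by (auto dest: subgroup.mem_carrier)
    have h: "?h \<in> generate G T"
      using ab K by (simp add: subgroup.m_closed subgroup.m_inv_closed)
    have dist: "d (pt a) (pt b) = disp ?h"
      using dist_pt_mult[of a ?h] abc by (simp add: m_assoc[symmetric])
    have "word_length G T ?h \<le> (L + A) * (disp ?h + B)"
    proof -
      have "L * disp ?h + 1 * B \<le> (L + A) * disp ?h + (L + A) * B"
        using LB A by (intro add_mono mult_right_mono) auto
      then show ?thesis using le[OF h] by (simp add: distrib_left)
    qed
    then show "word_dist G T a b / (L + A) - B \<le> d (pt a) (pt b)"
      using LB A by (simp add: dist word_dist_def pos_divide_le_eq algebra_simps)
    have "disp ?h \<le> A * word_length G T ?h"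
      using disp_le_word_length[OF T(2) h] A by blast
    also have "\<dots> \<le> (L + A) * word_length G T ?h + B"
      using LB by (simp add: mult_right_mono add_increasing2)
    finally show "d (pt a) (pt b) \<le> (L + A) * word_dist G T a b + B"
      by (simp add: dist word_dist_def)
  qed
  then show ?thesis
    unfolding qi_embedded_by_action_def finite_generating_set_def
    using K T base_in generate.incl[of _ T G] by blast
qed

text \<open>Three linear bounds are chained: length over \<open>S\<close> by length over
  \<open>T'\<close>, this by length over \<open>T\<close>, and the latter by displacement. The
  middle one is there because the hypothesis on \<open>K\<close> may come with a generating set of
  \<open>H\<close> other than \<open>T\<close>.\<close>

lemma undistorted_subgroup:
  assumes K: "qi_embedded_subgroup G K H" and T: "finite_generating_set G H T" "undistorted T L B"
  obtains S L' B' where "finite_generating_set G K S" "undistorted S L' B'"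
proof -
  obtain S T' where S: "finite_generating_set G K S" and T': "finite_generating_set G H T'"
    and sub: "subgroup K G" "subgroup H G" "K \<subseteq> H"
    and "quasi_isometric_embedding K (word_dist G S) (word_dist G T') (\<lambda>g. g)"
    using K unfolding qi_embedded_subgroup_def by blast
  then obtain L1 C1 where LC: "1 \<le> L1" "0 \<le> C1"
    and qi: "\<And>a b. a \<in> K \<Longrightarrow> b \<in> K \<Longrightarrow> word_dist G S a b / L1 - C1 \<le> word_dist G T' a b"
    unfolding quasi_isometric_embedding_def by metis
  have c: "H \<subseteq> carrier G" "S \<subseteq> carrier G" "T \<subseteq> carrier G" "T' \<subseteq> carrier G"
    using subgroup.subset[OF sub(2)] S T(1) T' sub(3) by (auto simp: finite_generating_set_def)
  obtain A :: real where A: "0 \<le> A" "\<And>g. g \<in> H \<Longrightarrow> word_length G T' g \<le> A * word_length G T g"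
  proof -
    have "finite T" "T \<subseteq> generate G T'" "generate G T = H"
      using T(1) T' by (auto simp: finite_generating_set_def)
    then show ?thesis using word_length_change_generators[of T T'] c that by blast
  qed
  have LB: "1 \<le> L" "0 \<le> B" "\<And>h. h \<in> H \<Longrightarrow> word_length G T h \<le> L * disp h + B"
    using T by (auto simp: undistorted_def finite_generating_set_def)
  \<comment> \<open>The summand 1 keeps the multiplicative constant at least 1 when \<open>A\<close>
    is 0.\<close>
  have "word_length G S h \<le> (L1 * (A * L) + 1) * disp h + L1 * (A * B + C1)" if h: "h \<in> K" for h
  proof -
    have "word_length G S h / L1 - C1 \<le> word_length G T' h"
      using qi[of \<one> h] h subgroup.one_closed[OF sub(1)] c sub(3) by (auto simp: word_dist_def)
    also have "\<dots> \<le> A * word_length G T h"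
      using A(2) h sub(3) by blast
    also have "\<dots> \<le> A * (L * disp h + B)"
      using A(1) LB(3) h sub(3) by (intro mult_left_mono) auto
    finally have "word_length G S h / L1 \<le> A * (L * disp h + B) + C1"
      by simp
    then have "word_length G S h \<le> L1 * (A * (L * disp h + B) + C1)"
      using LC by (simp add: pos_divide_le_eq mult.commute)
    also have "\<dots> \<le> (L1 * (A * L) + 1) * disp h + L1 * (A * B + C1)"
      by (simp add: algebra_simps)
    finally show ?thesis .
  qed
  moreover have "1 \<le> L1 * (A * L) + 1" "0 \<le> L1 * (A * B + C1)"
    using A(1) LB(1,2) LC by simp_all
  ultimately have "undistorted S (L1 * (A * L) + 1) (L1 * (A * B + C1))"
    using S c by (simp add: undistorted_def finite_generating_set_def)
  with S show ?thesis using that by blast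
qed

text \<open>A bound on displacement bounds word length, and word balls are finite. This is what
  makes the excluded set of the theorem finite.\<close>

lemma finite_short:
  assumes "undistorted T L B"
  shows "finite {h \<in> generate G T. disp h \<le> r}"
proof (rule finite_subset)
  have T: "finite T" "T \<subseteq> carrier G" "1 \<le> L"
    and le: "\<And>h. h \<in> generate G T \<Longrightarrow> word_length G T h \<le> L * disp h + B"
    using assms by (auto simp: undistorted_def)
  show "finite {g \<in> generate G T. real (word_length G T g) \<le> L * r + B}"
    by (rule finite_word_ball[OF T(1,2)])
  show "{h \<in> generate G T. disp h \<le> r} \<subseteq> {g \<in> generate G T. real (word_length G T g) \<le> L * r + B}"
  proof clarify
    fix h
    assume "h \<in> generate G T" "disp h \<le> r"
    then show "real (word_length G T h) \<le> L * r + B"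
      using le[of h] mult_left_mono[of "disp h" r L] T(3) by linarith
  qed
qed

end

section \<open>Separation of orbits with disjoint limit sets\<close>

text \<open>For each \<open>R\<close> the pigeonhole principle yields a subsequence of constant
  colour, on which \<open>P R\<close> holds for all pairs; a diagonal sequence then works for every
  \<open>R\<close> up to finitely many terms. With \<open>P R\<close> saying that Gromov products
  are at least \<open>R\<close>, this takes the place of a compactness argument.\<close>

lemma common_diagonal_subsequence:
  fixes u :: "nat \<Rightarrow> 'b" and P :: "nat \<Rightarrow> 'b \<Rightarrow> 'b \<Rightarrow> bool"
  assumes colour: "\<And>R. \<exists>N c F. finite F \<and> (\<forall>n\<ge>N. c (u n) \<in> F) \<and>
      (\<forall>m\<ge>N. \<forall>n\<ge>N. c (u m) = (c (u n) :: 'c) \<longrightarrow> P R (u m) (u n))"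
  obtains r :: "nat \<Rightarrow> nat" where "strict_mono r" "\<And>R. \<exists>N. \<forall>m\<ge>N. \<forall>n\<ge>N. P R (u (r m)) (u (r n))"
proof -
  interpret subseqs "\<lambda>R s. \<forall>m n. P R (u (s m)) (u (s n))"
  proof
    fix R :: nat and s :: "nat \<Rightarrow> nat"
    assume s: "strict_mono s"
    obtain N c F where F: "finite F" "\<And>n. n \<ge> N \<Longrightarrow> c (u n) \<in> F"
      and c: "\<And>m n. \<lbrakk>m \<ge> N; n \<ge> N; c (u m) = (c (u n) :: 'c)\<rbrakk> \<Longrightarrow> P R (u m) (u n)"
      using colour[of R] by blast
    have ge: "s n \<ge> N" if "n \<ge> N" for n
      using seq_suble[OF s, of n] that by simp
    have "(\<lambda>n. c (u (s n))) ` {N..} \<subseteq> F"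
      using F(2) ge by auto
    then have "finite ((\<lambda>n. c (u (s n))) ` {N..})"
      using F(1) finite_subset by blast
    then obtain n0 where inf: "infinite {n \<in> {N..}. c (u (s n)) = c (u (s n0))}"
      using pigeonhole_infinite[of "{N..}" "\<lambda>n. c (u (s n))"] infinite_Ici by blast
    obtain r :: "nat \<Rightarrow> nat" where r: "strict_mono r" "\<forall>k. r k \<in> {n \<in> {N..}. c (u (s n)) = c (u (s n0))}"
      using infinite_enumerate[OF inf] by blast
    have "P R (u ((s \<circ> r) m)) (u ((s \<circ> r) n))" for m n
      using r(2)[rule_format, of m] r(2)[rule_format, of n] ge by (intro c) auto
    with r(1) show "\<exists>r' :: nat \<Rightarrow> nat. strict_mono r' \<and> (\<forall>m n. P R (u ((s \<circ> r') m)) (u ((s \<circ> r') n)))"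
      by (intro exI[of _ r] conjI allI)
  qed
  have *: "\<forall>m n::nat. P R (u ((diagseq \<circ> (+) (Suc R)) m)) (u ((diagseq \<circ> (+) (Suc R)) n))" for R
    by (rule diagseq_holds) simp
  have "\<forall>m\<ge>Suc R. \<forall>n\<ge>Suc R. P R (u (diagseq m)) (u (diagseq n))" for R
  proof (intro allI impI)
    fix m n
    assume "m \<ge> Suc R" "n \<ge> Suc R"
    then show "P R (u (diagseq m)) (u (diagseq n))"
      using *[of R, rule_format, of "m - Suc R" "n - Suc R"] by simp
  qed
  with subseq_diagseq show ?thesis using that by blast
qed

context gromov_hyperbolic_metric
begin

lemma filterlim_gp_at_top_iff:
  "filterlim (\<lambda>(m, n). gp w (s m) (t n)) at_top (sequentially \<times>\<^sub>F sequentially) \<longleftrightarrow>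
     (\<forall>R::nat. \<exists>N. \<forall>m\<ge>N. \<forall>n\<ge>N. real R \<le> gp w (s m) (t n))"
proof
  assume "filterlim (\<lambda>(m, n). gp w (s m) (t n)) at_top (sequentially \<times>\<^sub>F sequentially)"
  then have "\<forall>\<^sub>F (m, n) in sequentially \<times>\<^sub>F sequentially. real R \<le> gp w (s m) (t n)" for R :: nat
    by (auto simp: filterlim_at_top case_prod_unfold)
  then show "\<forall>R::nat. \<exists>N. \<forall>m\<ge>N. \<forall>n\<ge>N. real R \<le> gp w (s m) (t n)"
    unfolding eventually_prod_sequentially case_prod_conv by blast
next
  assume *: "\<forall>R::nat. \<exists>N. \<forall>m\<ge>N. \<forall>n\<ge>N. real R \<le> gp w (s m) (t n)"
  show "filterlim (\<lambda>(m, n). gp w (s m) (t n)) at_top (sequentially \<times>\<^sub>F sequentially)"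
    unfolding filterlim_at_top eventually_prod_sequentially
  proof
    fix Z :: real
    obtain N where N: "\<forall>m\<ge>N. \<forall>n\<ge>N. real (nat \<lceil>Z\<rceil>) \<le> gp w (s m) (t n)"
      using * by blast
    have "Z \<le> gp w (s n) (t m)" if "m \<ge> N" "n \<ge> N" for m n
      using order_trans[OF real_nat_ceiling_ge] N that by blast
    then show "\<exists>N. \<forall>m\<ge>N. \<forall>n\<ge>N. Z \<le> (case (n, m) of (m, n) \<Rightarrow> gp w (s m) (t n))"
      by auto
  qed
qed

end

context hyperbolic_action
begin

text \<open>The colour of an element is an initial segment of fixed length of a geodesic word for it.\<close>
lemma undistorted_prefix_colouring:
  assumes und: "undistorted T L B"
  shows "\<exists>N c F. finite F \<and> (\<forall>h\<in>generate G T. N \<le> disp h \<longrightarrow> c h \<in> F) \<and>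
    (\<forall>h\<in>generate G T. \<forall>h'\<in>generate G T. N \<le> disp h \<longrightarrow> N \<le> disp h' \<longrightarrow>
       c h = (c h' :: 'g) \<longrightarrow> R \<le> gp x\<^sub>0 (pt h) (pt h'))"
proof -
  let ?T = "T \<union> m_inv G ` T"
  have T: "finite T" "T \<subseteq> carrier G" and LB: "1 \<le> L" "0 \<le> B"
    and le: "\<And>h. h \<in> generate G T \<Longrightarrow> word_length G T h \<le> L * disp h + B"
    using und by (auto simp: undistorted_def)
  have Tc: "?T \<subseteq> carrier G" using letters_in_carrier[OF T(2)] .
  obtain D where D: "0 \<le> D" "\<And>s. s \<in> ?T \<Longrightarrow> disp s \<le> D"
    using finite_letters_bound[OF T(1), of disp] by blast
  have "0 < L" using LB by simp
  have "filterlim (\<lambda>s. 2 ^ s / L - B / L - D - (real s + 1) * \<delta>) at_top sequentially"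
    using \<open>0 < L\<close> by real_asymp
  moreover have "filterlim (\<lambda>s. 2 ^ s :: real) at_top sequentially"
    by real_asymp
  \<comment> \<open>The exponential term outweighs the linear error. The additional \<delta> next to
    \<open>R\<close> pays for the later comparison, by \<open>hyp\<close>, of two elements with the
    same prefix.\<close>
  ultimately have "\<forall>\<^sub>F s in sequentially. R + \<delta> \<le> 2 ^ s / L - B / L - D - (real s + 1) * \<delta> \<and>
      2 * \<delta> * L \<le> 2 ^ s"
    by (auto simp: filterlim_at_top intro: eventually_conj)
  then obtain s where s: "R + \<delta> \<le> 2 ^ s / L - B / L - D - (real s + 1) * \<delta>" "2 * \<delta> * L \<le> 2 ^ s"
    using eventually_happens'[OF sequentially_bot] by blast
  define gs where "gs h = (SOME gs. length gs = word_length G T h \<and> set gs \<subseteq> ?T \<and> word_prod G gs = h)"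
    for h
  have gs: "length (gs h) = word_length G T h" "set (gs h) \<subseteq> ?T" "word_prod G (gs h) = h"
    if "h \<in> generate G T" for h
    using someI_ex[OF minimal_word[OF T(2) that]] unfolding gs_def by blast+
  define c where "c h = word_prod G (take (2 ^ s) (gs h))" for h
  let ?F = "word_prod G ` {gs. set gs \<subseteq> ?T \<and> length gs = 2 ^ s}"
  have prefix: "c h \<in> ?F \<and> c h \<in> carrier G \<and> R + \<delta> \<le> gp x\<^sub>0 (pt (c h)) (pt h)"
    if h: "h \<in> generate G T" "D * 2 ^ s \<le> disp h" "0 < disp h" for h
  proof -
    \<comment> \<open>A word with fewer than \<open>2 ^ s\<close> letters from \<open>?T\<close>
      moves the base point by less than \<open>D * 2 ^ s\<close> if \<open>D\<close> is positive, so
      \<open>h\<close> has a prefix of the chosen length.\<close>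
    have len: "2 ^ s \<le> length (gs h)"
    proof (rule ccontr)
      assume "\<not> 2 ^ s \<le> length (gs h)"
      then have l: "word_length G T h < 2 ^ s" using gs h by simp
      have d: "disp h \<le> D * word_length G T h"
        using disp_le_word_length[OF T(2) h(1)] D(2) by blast
      then have "D \<noteq> 0" using h(3) by auto
      then have "D * word_length G T h < D * 2 ^ s"
        using l D(1) by simp
      then show False using d h(2) by linarith
    qed
    have t: "set (take m (gs h)) \<subseteq> ?T" for m
      using gs(2)[OF h(1)] set_take_subset[of m "gs h"] by blast
    have tc: "word_prod G (take m (gs h)) \<in> carrier G" for m
      using t[of m] Tc by (intro word_prod_closed) blast
    have "c h \<in> ?F" unfolding c_def
      using t[of "2 ^ s"] len by (intro imageI) simp
    moreover have "2 ^ s / L - B / L - D - (real s + 1) * \<delta>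
        \<le> gp x\<^sub>0 (pt (word_prod G (take (2 ^ s) (gs h)))) (pt (word_prod G (take (length (gs h)) (gs h))))"
    proof (rule gp_quasi_geodesic[where a = "\<lambda>m. pt (word_prod G (take m (gs h)))"])
      fix m
      assume m: "m \<le> length (gs h)"
      let ?h = "word_prod G (take m (gs h))"
      have "?h \<in> generate G T"
        using t[of m] letters_in_generate[of T] by (intro word_prod_in_generate) blast
      then have "word_length G T ?h \<le> L * disp ?h + B" by (rule le)
      moreover have "word_length G T ?h = m"
        using gs[OF h(1)] m by (intro word_length_take[OF T(2)]) auto
      ultimately have "m \<le> (disp ?h + B / L) * L"
        using \<open>0 < L\<close> by (simp add: algebra_simps)
      then have "m / L \<le> disp ?h + B / L"
        using \<open>0 < L\<close> by (simp only: pos_divide_le_eq)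
      then show "m / L - B / L \<le> d (pt ?h) x\<^sub>0"
        by (simp add: commute)
    next
      fix m
      assume m: "m < length (gs h)"
      have a: "gs h ! m \<in> ?T" using gs(2)[OF h(1)] m nth_mem by blast
      have "word_prod G (take (Suc m) (gs h)) = word_prod G (take m (gs h)) \<otimes> gs h ! m"
      proof -
        have "set (take m (gs h)) \<subseteq> carrier G" "gs h ! m \<in> carrier G"
          using a t[of m] Tc by blast+
        then show ?thesis using m by (simp add: take_Suc_conv_app_nth word_prod_append)
      qed
      then show "d (pt (word_prod G (take m (gs h)))) (pt (word_prod G (take (Suc m) (gs h)))) \<le> D"
        using dist_pt_mult[OF tc, of "gs h ! m" m] a Tc D(2) by auto
    qed (use base_in \<open>0 < L\<close> tc pt_in D(1) s(2) len in auto)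
    ultimately show ?thesis
      using s(1) gs(3)[OF h(1)] tc[of "2 ^ s"] by (simp add: c_def)
  qed
  \<comment> \<open>The summand 1 makes the displacement positive, which excludes
    \<open>D = 0\<close> in the argument for \<open>len\<close>.\<close>
  let ?N = "D * 2 ^ s + 1"
  have N: "D * 2 ^ s \<le> disp h \<and> 0 < disp h" if "?N \<le> disp h" for h
    using that D(1) by (smt (verit) mult_nonneg_nonneg zero_le_power)
  show ?thesis
  proof (intro exI conjI ballI impI)
    show "finite ?F"
      using T(1) by (intro finite_imageI finite_lists_length_eq) simp
    show "c h \<in> ?F" if "h \<in> generate G T" "?N \<le> disp h" for h
      using prefix[of h] N[of h] that by blast
    fix h h'
    assume h: "h \<in> generate G T" "h' \<in> generate G T" "?N \<le> disp h" "?N \<le> disp h'" "c h = c h'"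
    then have "h \<in> carrier G" "h' \<in> carrier G"
      using generate_in_carrier[OF T(2)] by auto
    moreover have "c h \<in> carrier G" "R + \<delta> \<le> gp x\<^sub>0 (pt (c h)) (pt h)"
      "R + \<delta> \<le> gp x\<^sub>0 (pt (c h)) (pt h')"
      using prefix[of h] prefix[of h'] N[of h] N[of h'] h by auto
    ultimately show "R \<le> gp x\<^sub>0 (pt h) (pt h')"
      using hyp[of x\<^sub>0 "pt h" "pt (c h)" "pt h'"] base_in pt_in by (simp add: gp_commute)
  qed
qed

text \<open>Since \<open>h\<close> converges to infinity and \<open>h' n\<close> points in the
  direction of \<open>h n\<close>, two uses of \<open>hyp\<close> show that the mixed products and
  those of \<open>h'\<close> tend to infinity as well. The two orbit sequences thus represent one
  boundary point.\<close>

lemma limit_sets_meet: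
  assumes h: "\<And>n. h n \<in> H" "\<And>n. h' n \<in> H'" "H \<subseteq> carrier G" "H' \<subseteq> carrier G"
    and lim: "\<And>R. \<exists>N. \<forall>m\<ge>N. \<forall>n\<ge>N. real R \<le> gp x\<^sub>0 (pt (h m)) (pt (h n))"
      "\<And>n. real n \<le> gp x\<^sub>0 (pt (h n)) (pt (h' n))"
  shows "limit_set X d \<phi> x\<^sub>0 H \<inter> limit_set X d \<phi> x\<^sub>0 H' \<noteq> {}"
proof -
  let ?s = "\<lambda>n. pt (h n)" and ?t = "\<lambda>n. pt (h' n)"
  have X: "?s n \<in> X" "?t n \<in> X" for n
    using h by (blast intro: pt_in)+
  have st: "\<exists>N. \<forall>m\<ge>N. \<forall>n\<ge>N. real R \<le> gp x\<^sub>0 (?s m) (?t n)" for R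
  proof -
    obtain k where k: "\<delta> \<le> real k" using real_arch_simple by blast
    obtain N where N: "\<forall>m\<ge>N. \<forall>n\<ge>N. real (R + k) \<le> gp x\<^sub>0 (?s m) (?s n)"
      using lim(1) by blast
    show ?thesis
    proof (intro exI allI impI)
      fix m n
      assume mn: "max N (R + k) \<le> m" "max N (R + k) \<le> n"
      then have "real (R + k) \<le> gp x\<^sub>0 (?s m) (?s n)" "real (R + k) \<le> gp x\<^sub>0 (?s n) (?t n)"
        using N order_trans[OF _ lim(2)[of n], of "real (R + k)"] by auto
      then show "real R \<le> gp x\<^sub>0 (?s m) (?t n)"
        using hyp[of x\<^sub>0 "?s m" "?s n" "?t n"] X base_in k by simp
    qed
  qed
  have tt: "\<exists>N. \<forall>m\<ge>N. \<forall>n\<ge>N. real R \<le> gp x\<^sub>0 (?t m) (?t n)" for R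
  proof -
    obtain k where k: "\<delta> \<le> real k" using real_arch_simple by blast
    obtain N where N: "\<forall>m\<ge>N. \<forall>n\<ge>N. real (R + k) \<le> gp x\<^sub>0 (?s m) (?t n)"
      using st by blast
    show ?thesis
    proof (intro exI allI impI)
      fix m n
      assume mn: "N \<le> m" "N \<le> n"
      then have "real (R + k) \<le> gp x\<^sub>0 (?s n) (?t m)" "real (R + k) \<le> gp x\<^sub>0 (?s n) (?t n)"
        using N by auto
      then show "real R \<le> gp x\<^sub>0 (?t m) (?t n)"
        using hyp[of x\<^sub>0 "?t m" "?s n" "?t n"] X base_in k by (simp add: gp_commute)
    qed
  qed
  have conv: "converges_to_infinity X d x\<^sub>0 ?s" "converges_to_infinity X d x\<^sub>0 ?t"
    unfolding converges_to_infinity_def filterlim_gp_at_top_iff using X lim(1) tt by auto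
  let ?p = "boundary_rel X d x\<^sub>0 `` {?s}"
  have "?p \<in> gromov_boundary X d x\<^sub>0"
    unfolding gromov_boundary_def using conv(1) by (intro quotientI) simp
  moreover have "?s \<in> ?p" "?t \<in> ?p"
    using conv lim(1) st by (auto simp: boundary_rel_def filterlim_gp_at_top_iff)
  ultimately have "?p \<in> limit_set X d \<phi> x\<^sub>0 H" "?p \<in> limit_set X d \<phi> x\<^sub>0 H'"
    unfolding limit_set_def using h(1,2) by blast+
  then show ?thesis by blast
qed

text \<open>If the products were unbounded, pairs with product above \<open>n\<close> would have
  first components of displacement tending to infinity. The colouring by prefixes and the diagonal
  argument make these converge along a subsequence, and \<open>limit_sets_meet\<close> yields a
  common limit point.\<close>

lemma disjoint_limit_sets_bound:
  assumes und: "undistorted T L B" and H': "H' \<subseteq> carrier G"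
    and disj: "limit_set X d \<phi> x\<^sub>0 (generate G T) \<inter> limit_set X d \<phi> x\<^sub>0 H' = {}"
  shows "\<exists>C. \<forall>h\<in>generate G T. \<forall>h'\<in>H'. gp x\<^sub>0 (pt h) (pt h') \<le> C"
proof (rule ccontr)
  assume "\<nexists>C. \<forall>h\<in>generate G T. \<forall>h'\<in>H'. gp x\<^sub>0 (pt h) (pt h') \<le> C"
  then have "\<forall>n::nat. \<exists>h h'. h \<in> generate G T \<and> h' \<in> H' \<and> real n < gp x\<^sub>0 (pt h) (pt h')"
    by (metis linorder_not_less)
  then obtain h h' :: "nat \<Rightarrow> 'g" where h: "\<And>n. h n \<in> generate G T" "\<And>n. h' n \<in> H'"
    and gt: "\<And>n::nat. real n < gp x\<^sub>0 (pt (h n)) (pt (h' n))"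
    by metis
  have Tc: "generate G T \<subseteq> carrier G"
    using und generate_incl by (simp add: undistorted_def)
  have disp: "real n \<le> disp (h n)" for n
  proof -
    have "h n \<in> carrier G" "h' n \<in> carrier G" using h[of n] H' Tc by blast+
    then have "gp x\<^sub>0 (pt (h n)) (pt (h' n)) \<le> d (pt (h n)) x\<^sub>0"
      using base_in pt_in by (intro gp_le_dist) auto
    then show ?thesis using gt[of n] commute[of x\<^sub>0 "pt (h n)"] by linarith
  qed
  have "\<exists>N c F. finite F \<and> (\<forall>n\<ge>N. c (h n) \<in> F) \<and>
      (\<forall>m\<ge>N. \<forall>n\<ge>N. c (h m) = (c (h n) :: 'g) \<longrightarrow> real R \<le> gp x\<^sub>0 (pt (h m)) (pt (h n)))" for R
  proof -
    obtain N c F where F: "finite F" "\<And>k. k \<in> generate G T \<Longrightarrow> N \<le> disp k \<Longrightarrow> c k \<in> F"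
      "\<And>k k'. \<lbrakk>k \<in> generate G T; k' \<in> generate G T; N \<le> disp k; N \<le> disp k'; c k = (c k' :: 'g)\<rbrakk>
        \<Longrightarrow> real R \<le> gp x\<^sub>0 (pt k) (pt k')"
      using undistorted_prefix_colouring[OF und, of "real R"] by metis
    have "N \<le> disp (h n)" if "nat \<lceil>N\<rceil> \<le> n" for n
      using disp[of n] that by linarith
    with F h(1) show ?thesis
      by (intro exI[of _ "nat \<lceil>N\<rceil>"] exI[of _ c] exI[of _ F]) simp
  qed
  from common_diagonal_subsequence[where P = "\<lambda>R x y. real R \<le> gp x\<^sub>0 (pt x) (pt y)", OF this]
  obtain r :: "nat \<Rightarrow> nat" where r: "strict_mono r"
    "\<And>R. \<exists>N. \<forall>m\<ge>N. \<forall>n\<ge>N. real R \<le> gp x\<^sub>0 (pt (h (r m))) (pt (h (r n)))"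
    by blast
  have "real n \<le> gp x\<^sub>0 (pt (h (r n))) (pt (h' (r n)))" for n
    using gt[of "r n"] seq_suble[OF r(1), of n] by linarith
  then have "limit_set X d \<phi> x\<^sub>0 (generate G T) \<inter> limit_set X d \<phi> x\<^sub>0 H' \<noteq> {}"
    using h r(2) Tc H' by (intro limit_sets_meet[of "h \<circ> r" _ "h' \<circ> r"]) auto
  with disj show False by simp
qed

end

section \<open>Reduced words in a family of subgroups\<close>

definition reduced_word :: "('g, 'b) monoid_scheme \<Rightarrow> ('i \<times> 'g) list \<Rightarrow> bool" where
  "reduced_word G w \<longleftrightarrow> (\<forall>x\<in>set w. snd x \<noteq> \<one>\<^bsub>G\<^esub>) \<and> distinct_adj (map fst w)"

locale subgroup_family = group G for G :: "('g, 'b) monoid_scheme" (structure) +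
  fixes I :: "'i set" and K :: "'i \<Rightarrow> 'g set"
  assumes subgroups: "i \<in> I \<Longrightarrow> subgroup (K i) G"
begin

abbreviation Gs where "Gs \<equiv> \<lambda>i. G\<lparr>carrier := K i\<rparr>"

abbreviation wval where "wval w \<equiv> word_prod G (map snd w)"

lemma factor_group: "i \<in> I \<Longrightarrow> group (Gs i)"
  using subgroups subgroup_imp_group by blast

lemma words_Nil [simp]: "[] \<in> fp_words I Gs"
  by (simp add: fp_words_def)

lemma words_Cons [simp]:
  "x # w \<in> fp_words I Gs \<longleftrightarrow> fst x \<in> I \<and> snd x \<in> K (fst x) \<and> w \<in> fp_words I Gs"
  by (cases x) (simp add: fp_words_def)

lemma words_nth: "w \<in> fp_words I Gs \<Longrightarrow> j < length w \<Longrightarrow> fst (w ! j) \<in> I \<and> snd (w ! j) \<in> K (fst (w ! j))"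
  by (induction w arbitrary: j) (auto simp: nth_Cons split: nat.splits)

lemma words_take: "w \<in> fp_words I Gs \<Longrightarrow> take j w \<in> fp_words I Gs"
  by (auto simp: fp_words_def lists_eq_set dest: in_set_takeD)

lemma letter_closed: "i \<in> I \<Longrightarrow> a \<in> K i \<Longrightarrow> a \<in> carrier G"
  using subgroups subgroup.mem_carrier by metis

lemma words_carrier: "w \<in> fp_words I Gs \<Longrightarrow> set (map snd w) \<subseteq> carrier G"
  by (induction w) (auto intro: letter_closed)

lemma wval_closed: "w \<in> fp_words I Gs \<Longrightarrow> wval w \<in> carrier G"
  by (rule word_prod_closed[OF words_carrier])

lemma wval_append:
  "u \<in> fp_words I Gs \<Longrightarrow> v \<in> fp_words I Gs \<Longrightarrow> wval (u @ v) = wval u \<otimes> wval v"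
  using word_prod_append[OF words_carrier words_carrier] by simp

lemma wval_take_Suc:
  assumes "w \<in> fp_words I Gs" "j < length w"
  shows "wval (take (Suc j) w) = wval (take j w) \<otimes> snd (w ! j)"
proof -
  have "fst (w ! j) \<in> I" "snd (w ! j) \<in> K (fst (w ! j))" using words_nth[OF assms] by auto
  moreover from this have "snd (w ! j) \<in> carrier G" by (rule letter_closed)
  ultimately show ?thesis
    using wval_append[OF words_take[OF assms(1)], of "[w ! j]" j] assms(2)
    by (simp add: take_Suc_conv_app_nth)
qed

lemma wval_class: "w \<in> fp_words I Gs \<Longrightarrow> free_product_map G (fp_rel I Gs `` {w}) = wval w"
  by (rule free_product_map_class[OF is_group subgroups])

lemma wval_fp_rel:
  assumes "(u, v) \<in> fp_rel I Gs"
  shows "wval u = wval v"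
proof -
  have "u \<in> fp_words I Gs" "v \<in> fp_words I Gs"
    using fp_rel_words[OF factor_group assms] by auto
  moreover have "fp_rel I Gs `` {u} = fp_rel I Gs `` {v}"
    using equiv_class_eq[OF equiv_fp_rel[of I Gs, OF factor_group] assms] by simp
  ultimately show ?thesis using wval_class by metis
qed

text \<open>A trivial letter is dropped, a letter of a new factor is kept, and a letter of the same
  factor as the head is merged with it. If the merged letter is trivial, what remains is the tail,
  which is already reduced.\<close>

lemma reduced_word_Cons:
  assumes i: "i \<in> I" "a \<in> K i" and r: "r \<in> fp_words I Gs" "reduced_word G r"
  shows "\<exists>r'\<in>fp_words I Gs. ((i, a) # r, r') \<in> fp_rel I Gs \<and> reduced_word G r'"
proof -
  have one: "((i, \<one>) # s, s) \<in> fp_rel I Gs" if "s \<in> fp_words I Gs" for s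
    using fp_one[of "[]" I Gs s i] that i by simp
  consider "a = \<one>" | "a \<noteq> \<one>" "r = [] \<or> fst (hd r) \<noteq> i" | "a \<noteq> \<one>" "r \<noteq> []" "fst (hd r) = i"
    by blast
  then show ?thesis
  proof cases
    case 1
    then show ?thesis using one[OF r(1)] r by blast
  next
    case 2
    then have "reduced_word G ((i, a) # r)"
      using r(2) by (cases r) (auto simp: reduced_word_def)
    then show ?thesis
      using i r by (intro bexI[of _ "(i, a) # r"] conjI fp_refl) auto
  next
    case 3
    then obtain b s where r': "r = (i, b) # s" by (cases r) auto
    have s: "s \<in> fp_words I Gs" "b \<in> K i" "reduced_word G s"
      using r r' by (auto simp: reduced_word_def distinct_adj_Cons)
    have ab: "a \<otimes> b \<in> K i"
      using subgroup.m_closed[OF subgroups] i s by blast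
    have rel: "((i, a) # r, (i, a \<otimes> b) # s) \<in> fp_rel I Gs"
      using fp_mult[of "[]" I Gs s i a b] i s r' by simp
    show ?thesis
    proof (cases "a \<otimes> b = \<one>")
      case True
      then show ?thesis using fp_trans[OF rel] one[OF s(1)] s by auto
    next
      case False
      then have "reduced_word G ((i, a \<otimes> b) # s)"
        using r r' by (auto simp: reduced_word_def distinct_adj_Cons)
      then show ?thesis
        using i s ab rel by (intro bexI[of _ "(i, a \<otimes> b) # s"] conjI) auto
    qed
  qed
qed

lemma reduced_word_exists:
  "w \<in> fp_words I Gs \<Longrightarrow> \<exists>r\<in>fp_words I Gs. (w, r) \<in> fp_rel I Gs \<and> reduced_word G r"
proof (induction w)
  case Nil
  then show ?case by (intro bexI[of _ "[]"]) (auto simp: reduced_word_def intro: fp_refl)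
next
  case (Cons x w)
  then obtain r where r: "r \<in> fp_words I Gs" "(w, r) \<in> fp_rel I Gs" "reduced_word G r"
    by auto
  have "(x # w, x # r) \<in> fp_rel I Gs"
    using fp_rel_append_left[of "[x]" I Gs w r] Cons.prems r(2) by simp
  moreover obtain r' where "r' \<in> fp_words I Gs" "(x # r, r') \<in> fp_rel I Gs" "reduced_word G r'"
    using reduced_word_Cons[of "fst x" "snd x" r] Cons.prems r by auto
  ultimately show ?case using fp_trans by blast
qed

lemma wval_in_generate: "w \<in> fp_words I Gs \<Longrightarrow> wval w \<in> generate G (\<Union>i\<in>I. K i)"
proof (induction w)
  case Nil
  then show ?case by (simp add: generate.one)
next
  case (Cons x w)
  then have "snd x \<in> generate G (\<Union>i\<in>I. K i)" by (auto intro: generate.incl)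
  then show ?case using Cons by (auto intro: generate.eng)
qed

lemma generate_imp_wval:
  assumes "g \<in> generate G (\<Union>i\<in>I. K i)"
  shows "\<exists>w\<in>fp_words I Gs. wval w = g"
  using assms
proof (induction rule: generate.induct)
  case one
  then show ?case by (intro bexI[of _ "[]"]) auto
next
  case (incl h)
  then obtain i where "i \<in> I" "h \<in> K i" by blast
  then show ?case using letter_closed by (intro bexI[of _ "[(i, h)]"]) auto
next
  case (inv h)
  then obtain i where "i \<in> I" "inv h \<in> K i" using subgroups subgroup.m_inv_closed by fastforce
  then show ?case using letter_closed by (intro bexI[of _ "[(i, inv h)]"]) auto
next
  case (eng g h)
  then obtain u v where "u \<in> fp_words I Gs" "wval u = g" "v \<in> fp_words I Gs" "wval v = h" by blast
  then show ?case
    using wval_append[of u v] by (intro bexI[of _ "u @ v"]) (auto simp: fp_words_def)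
qed

lemma generate_imp_reduced:
  assumes "g \<in> generate G (\<Union>i\<in>I. K i)"
  shows "\<exists>w\<in>fp_words I Gs. reduced_word G w \<and> wval w = g"
proof -
  obtain w where w: "w \<in> fp_words I Gs" "wval w = g" using generate_imp_wval[OF assms] by blast
  then obtain r where "r \<in> fp_words I Gs" "(w, r) \<in> fp_rel I Gs" "reduced_word G r"
    using reduced_word_exists by blast
  then show ?thesis using wval_fp_rel w(2) by metis
qed

lemma generators_subset: "(\<Union>i\<in>I. K i) \<subseteq> carrier G"
  using letter_closed by blast

text \<open>Injectivity is where \<open>nontrivial\<close> enters: a class in the kernel contains a
  reduced word, and this word must be empty.\<close>

lemma free_product_iso:
  assumes nontrivial: "\<And>w. \<lbrakk>w \<in> fp_words I Gs; reduced_word G w; w \<noteq> []\<rbrakk> \<Longrightarrow> wval w \<noteq> \<one>"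
  shows "free_product_map G \<in> iso (free_product I Gs) (G\<lparr>carrier := generate G (\<Union>i\<in>I. K i)\<rparr>)"
proof -
  let ?F = "free_product I Gs" and ?K = "G\<lparr>carrier := generate G (\<Union>i\<in>I. K i)\<rparr>"
  have carrier: "carrier ?F = fp_words I Gs // fp_rel I Gs"
    and one: "\<one>\<^bsub>?F\<^esub> = fp_rel I Gs `` {[]}"
    by (simp_all add: free_product_def)
  have app: "u @ v \<in> fp_words I Gs" if "u \<in> fp_words I Gs" "v \<in> fp_words I Gs" for u v
    using that by (auto simp: fp_words_def)
  have "free_product_map G \<in> hom ?F ?K"
  proof (rule homI)
    fix x
    assume "x \<in> carrier ?F"
    then show "free_product_map G x \<in> carrier ?K"
      unfolding carrier by (auto elim!: quotientE simp: wval_class wval_in_generate)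
  next
    fix x y
    assume "x \<in> carrier ?F" "y \<in> carrier ?F"
    then obtain u v where uv: "u \<in> fp_words I Gs" "x = fp_rel I Gs `` {u}"
        "v \<in> fp_words I Gs" "y = fp_rel I Gs `` {v}"
      unfolding carrier by (auto elim!: quotientE)
    then have "x \<otimes>\<^bsub>?F\<^esub> y = fp_rel I Gs `` {u @ v}"
      using free_product_mult[of I Gs u v, OF factor_group] by simp
    then show "free_product_map G (x \<otimes>\<^bsub>?F\<^esub> y) = free_product_map G x \<otimes>\<^bsub>?K\<^esub> free_product_map G y"
      using uv by (simp add: wval_class app wval_append del: map_append)
  qed
  then have "group_hom ?F ?K (free_product_map G)"
    using group_free_product[of I Gs, OF factor_group]
      subgroup_imp_group[OF generate_is_subgroup[OF generators_subset]]
    by (simp add: group_hom_def group_hom_axioms_def)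
  moreover have "carrier ?K \<subseteq> free_product_map G ` carrier ?F"
  proof
    fix g
    assume "g \<in> carrier ?K"
    then obtain w where w: "w \<in> fp_words I Gs" "wval w = g" using generate_imp_wval by auto
    show "g \<in> free_product_map G ` carrier ?F"
    proof (rule image_eqI)
      show "g = free_product_map G (fp_rel I Gs `` {w})" using wval_class[OF w(1)] w(2) by simp
      show "fp_rel I Gs `` {w} \<in> carrier ?F" unfolding carrier by (rule quotientI[OF w(1)])
    qed
  qed
  moreover have "x = \<one>\<^bsub>?F\<^esub>" if x: "x \<in> carrier ?F" "free_product_map G x = \<one>\<^bsub>?K\<^esub>" for x
  proof -
    obtain w where w: "w \<in> fp_words I Gs" "x = fp_rel I Gs `` {w}"
      using x(1) unfolding carrier by (auto elim!: quotientE)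
    obtain r where r: "r \<in> fp_words I Gs" "(w, r) \<in> fp_rel I Gs" "reduced_word G r"
      using reduced_word_exists[OF w(1)] by blast
    have "wval r = \<one>"
      using x(2) w wval_fp_rel[OF r(2)] by (simp add: wval_class)
    then have "r = []" using nontrivial r by blast
    then show ?thesis
      unfolding one w(2) using equiv_class_eq[OF equiv_fp_rel[of I Gs, OF factor_group] r(2)] by simp
  qed
  ultimately show ?thesis by (simp add: group_hom.iso_iff)
qed

end

section \<open>Almost stabilizers\<close>

lemma finite_card_fibres:
  assumes "finite B" "f ` A \<subseteq> B" and fibre: "\<And>a. a \<in> A \<Longrightarrow> finite {x \<in> A. f x = f a} \<and> card {x \<in> A. f x = f a} \<le> m"
  shows "finite A \<and> card A \<le> card B * m"
proof -
  have *: "finite {x \<in> A. f x = b} \<and> card {x \<in> A. f x = b} \<le> m" for b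
  proof (cases "{x \<in> A. f x = b} = {}")
    case True
    then show ?thesis by (simp only: card.empty finite.emptyI le0 simp_thms)
  next
    case False
    then obtain a where "a \<in> A" "f a = b" by blast
    then show ?thesis using fibre[of a] by simp
  qed
  have A: "A = (\<Union>b\<in>B. {x \<in> A. f x = b})" using assms(2) by auto
  have "finite (\<Union>b\<in>B. {x \<in> A. f x = b})" using assms(1) * by blast
  moreover have "card (\<Union>b\<in>B. {x \<in> A. f x = b}) \<le> (\<Sum>b\<in>B. card {x \<in> A. f x = b})"
    by (rule card_UN_le[OF assms(1)])
  moreover have "(\<Sum>b\<in>B. card {x \<in> A. f x = b}) \<le> card B * m"
    using sum_bounded_above[of B "\<lambda>b. card {x \<in> A. f x = b}" m] * by simp
  ultimately show ?thesis using A by simp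
qed

text \<open>The window contains \<open>\<lceil>2 * e\<rceil> + 1\<close> integers, whatever
  \<open>a\<close> is; this later counts translation lengths up to rounding.\<close>

lemma floor_in_window:
  fixes a b e :: real
  assumes "\<bar>b - a\<bar> \<le> e"
  shows "\<lfloor>b\<rfloor> \<in> {\<lfloor>a - e\<rfloor>..\<lfloor>a - e\<rfloor> + \<lceil>2 * e\<rceil>}"
proof -
  have "\<lfloor>a - e\<rfloor> \<le> \<lfloor>b\<rfloor>" using assms by (intro floor_mono) linarith
  moreover have "\<lfloor>b\<rfloor> \<le> \<lfloor>a - e\<rfloor> + \<lceil>2 * e\<rceil>" using assms by linarith
  ultimately show ?thesis by simp
qed

context hyperbolic_action
begin

definition almost_stab :: "real \<Rightarrow> 'x \<Rightarrow> 'x \<Rightarrow> 'g set" where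
  "almost_stab \<epsilon> x y = {g \<in> carrier G. d (\<phi> g x) x \<le> \<epsilon> \<and> d (\<phi> g y) y \<le> \<epsilon>}"

text \<open>Finiteness is demanded separately because \<open>card\<close> of an infinite set is
  0.\<close>

definition small :: "'g set \<Rightarrow> real \<Rightarrow> bool" where
  "small A M \<longleftrightarrow> finite A \<and> real (card A) \<le> M"

lemma small_subset: "small A M \<Longrightarrow> B \<subseteq> A \<Longrightarrow> M \<le> N \<Longrightarrow> small B N"
  unfolding small_def by (metis card_mono finite_subset of_nat_mono order_trans)

lemma small_image: "small A M \<Longrightarrow> small (f ` A) M"
  unfolding small_def by (meson card_image_le finite_imageI of_nat_mono order_trans)

text \<open>If \<open>g\<close> almost fixes the translated pair, its conjugate
  \<open>inv u \<otimes> g \<otimes> u\<close> almost fixes the original one. Cardinality bounds for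
  pairs starting at the base point thus hold for all translates.\<close>

lemma almost_stab_translate:
  assumes u: "u \<in> carrier G" and X: "x \<in> X" "y \<in> X"
  shows "almost_stab \<epsilon> (\<phi> u x) (\<phi> u y) \<subseteq> (\<lambda>g. u \<otimes> g \<otimes> inv u) ` almost_stab \<epsilon> x y"
proof
  fix g
  assume "g \<in> almost_stab \<epsilon> (\<phi> u x) (\<phi> u y)"
  then have g: "g \<in> carrier G" "d (\<phi> g (\<phi> u x)) (\<phi> u x) \<le> \<epsilon>" "d (\<phi> g (\<phi> u y)) (\<phi> u y) \<le> \<epsilon>"
    by (auto simp: almost_stab_def)
  let ?h = "inv u \<otimes> g \<otimes> u"
  have h: "?h \<in> carrier G" using u g by simp
  have eq: "u \<otimes> ?h = g \<otimes> u" using u g by (simp add: m_assoc[symmetric])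
  have *: "d (\<phi> ?h z) z = d (\<phi> g (\<phi> u z)) (\<phi> u z)" if "z \<in> X" for z
  proof -
    have "d (\<phi> ?h z) z = d (\<phi> u (\<phi> ?h z)) (\<phi> u z)"
      using u h that act_in by (simp add: isometry)
    also have "\<phi> u (\<phi> ?h z) = \<phi> (u \<otimes> ?h) z" using u h that by (simp add: act_mult)
    also have "\<dots> = \<phi> g (\<phi> u z)" unfolding eq using u g that by (simp add: act_mult)
    finally show ?thesis .
  qed
  have "?h \<in> almost_stab \<epsilon> x y" using h g *[OF X(1)] *[OF X(2)] by (simp add: almost_stab_def)
  moreover have "g = u \<otimes> ?h \<otimes> inv u" unfolding eq using u g by (simp add: m_assoc)
  ultimately show "g \<in> (\<lambda>g. u \<otimes> g \<otimes> inv u) ` almost_stab \<epsilon> x y" by blast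
qed

lemma gp_moved:
  assumes g: "g \<in> almost_stab \<epsilon> x y" and X: "x \<in> X" "y \<in> X" "p \<in> X" and c: "gp p x y \<le> c"
  shows "gp (\<phi> g p) x y \<le> c + \<epsilon>" "\<bar>d x (\<phi> g p) - d x p\<bar> \<le> \<epsilon>"
proof -
  have gc: "g \<in> carrier G" "d (\<phi> g x) x \<le> \<epsilon>" "d (\<phi> g y) y \<le> \<epsilon>"
    using g by (auto simp: almost_stab_def)
  have gX: "\<phi> g x \<in> X" "\<phi> g y \<in> X" "\<phi> g p \<in> X" using gc X act_in by auto
  have "d (\<phi> g x) (\<phi> g p) = d x p" "d (\<phi> g y) (\<phi> g p) = d y p"
    using gc X by (simp_all add: isometry)
  then show "gp (\<phi> g p) x y \<le> c + \<epsilon>" "\<bar>d x (\<phi> g p) - d x p\<bar> \<le> \<epsilon>"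
    using triangle[OF X(1) gX(1,3)] triangle[OF X(2) gX(2,3)] triangle[OF gX(1) X(1) gX(3)] gc(2,3) c
      commute[of x "\<phi> g x"] commute[of y "\<phi> g y"]
    by (auto simp: gromov_product_def field_simps)
qed

text \<open>Both \<open>p\<close> and its image lie near a geodesic from \<open>x\<close> to
  \<open>y\<close>, at nearly the same distance from \<open>x\<close>, so
  \<open>dist_le_of_gp_le\<close> applies. The bound grows with \<epsilon> and is therefore used on
  very long segments only.\<close>

lemma displacement_near_geodesic:
  assumes g: "g \<in> almost_stab \<epsilon> x y" and X: "x \<in> X" "y \<in> X" "p \<in> X" and c: "gp p x y \<le> c"
    and "0 \<le> \<epsilon>"
  shows "d (\<phi> g p) p \<le> 3 * \<epsilon> + 2 * c + 2 * \<delta>"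
proof -
  have "\<phi> g p \<in> X" using g X act_in by (auto simp: almost_stab_def)
  then have "d (\<phi> g p) p \<le> \<bar>d x (\<phi> g p) - d x p\<bar> + 2 * (c + \<epsilon>) + 2 * \<delta>"
    using gp_moved[OF g X c] X c \<open>0 \<le> \<epsilon>\<close> by (intro dist_le_of_gp_le[where y = y]) auto
  then show ?thesis using gp_moved(2)[OF g X c] by simp
qed

text \<open>Far from both endpoints the dependence of the Gromov product on \<open>\<epsilon>\<close> disappears.\<close>
lemma gp_moved_far:
  assumes g: "g \<in> almost_stab \<epsilon> x y" and X: "x \<in> X" "y \<in> X" "p \<in> X" and c: "gp p x y \<le> c"
    and far: "\<epsilon> + c + 2 * \<delta> < d x p" "\<epsilon> + c + 2 * \<delta> < d y p"
  shows "gp (\<phi> g p) x y \<le> c + 2 * \<delta>"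
proof -
  have gc: "g \<in> carrier G" "d (\<phi> g x) x \<le> \<epsilon>" "d (\<phi> g y) y \<le> \<epsilon>"
    using g by (auto simp: almost_stab_def)
  have gX: "\<phi> g x \<in> X" "\<phi> g y \<in> X" "\<phi> g p \<in> X" using gc X act_in by auto
  \<comment> \<open>Seen from the distant point \<open>\<phi> g p\<close>, the nearby points
    \<open>x\<close> and \<open>\<phi> g x\<close> lie in almost the same direction, and likewise
    for \<open>y\<close>. Replacing the two images one at a time costs one \<delta> each.\<close>
  have "gp (\<phi> g p) (\<phi> g x) (\<phi> g y) \<le> c" using gp_act gc X c by simp
  moreover have "c + 2 * \<delta> < gp (\<phi> g p) (\<phi> g x) x"
    using gp_ge[OF gX(3,1) X(1)] gc far isometry[OF gc(1) X(1,3)] by simp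
  moreover have "c + 2 * \<delta> < gp (\<phi> g p) y (\<phi> g y)"
    using gp_ge[OF gX(3,2) X(2)] gc far isometry[OF gc(1) X(2,3)] by (simp add: gp_commute)
  moreover have "min (gp (\<phi> g p) (\<phi> g x) x) (gp (\<phi> g p) x (\<phi> g y)) - \<delta> \<le> gp (\<phi> g p) (\<phi> g x) (\<phi> g y)"
    "min (gp (\<phi> g p) x y) (gp (\<phi> g p) y (\<phi> g y)) - \<delta> \<le> gp (\<phi> g p) x (\<phi> g y)"
    using gX X by (auto intro!: hyp)
  ultimately show ?thesis using delta_nonneg by (simp add: min_def split: if_splits)
qed

text \<open>Elements almost fixing \<open>x\<close> and \<open>y\<close> slide the two points \<open>p, q\<close> along a geodesic; two elements
  that slide them by nearly the same amounts differ by an element moving \<open>p, q\<close> by a constant that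
  does not depend on \<open>\<epsilon>\<close>.\<close>
lemma small_almost_stab_middle:
  fixes M :: real
  assumes X: "x \<in> X" "y \<in> X" "p \<in> X" "q \<in> X" and c: "gp p x y \<le> c" "gp q x y \<le> c" and "0 \<le> \<epsilon>"
    and far: "\<epsilon> + c + 2 * \<delta> < d x p" "\<epsilon> + c + 2 * \<delta> < d y p"
      "\<epsilon> + c + 2 * \<delta> < d x q" "\<epsilon> + c + 2 * \<delta> < d y q"
    and M: "small (almost_stab (1 + 2 * (c + 2 * \<delta>) + 2 * \<delta>) p q) M"
  shows "small (almost_stab \<epsilon> x y) ((\<lceil>2 * \<epsilon>\<rceil> + 1)\<^sup>2 * M)"
proof -
  let ?A = "almost_stab \<epsilon> x y" and ?S = "almost_stab (1 + 2 * (c + 2 * \<delta>) + 2 * \<delta>) p q"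
  \<comment> \<open>\<open>f\<close> records the rounded positions of the two image points along the
    geodesic; \<open>floor_in_window\<close> bounds the number of its values.\<close>
  define f where "f g = (\<lfloor>d x (\<phi> g p)\<rfloor>, \<lfloor>d x (\<phi> g q)\<rfloor>)" for g
  let ?B = "{\<lfloor>d x p - \<epsilon>\<rfloor>..\<lfloor>d x p - \<epsilon>\<rfloor> + \<lceil>2 * \<epsilon>\<rceil>} \<times> {\<lfloor>d x q - \<epsilon>\<rfloor>..\<lfloor>d x q - \<epsilon>\<rfloor> + \<lceil>2 * \<epsilon>\<rceil>}"
  have "f ` ?A \<subseteq> ?B"
    using floor_in_window gp_moved(2)[OF _ X(1,2)] X c unfolding f_def by blast
  moreover have "finite {h \<in> ?A. f h = f g} \<and> card {h \<in> ?A. f h = f g} \<le> card ?S"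
    if g: "g \<in> ?A" for g
  proof -
    \<comment> \<open>With equal floors the images of \<open>z\<close> under \<open>g\<close> and
      \<open>h\<close> have distances to \<open>x\<close> within 1, and by
      \<open>gp_moved_far\<close> both have product at most c + 2\<delta>; the bound is that of
      \<open>dist_le_of_gp_le\<close> for these data.\<close>
    have close: "d (\<phi> (inv g \<otimes> h) z) z \<le> 1 + 2 * (c + 2 * \<delta>) + 2 * \<delta>"
      if h: "h \<in> ?A" and z: "z \<in> X" "gp z x y \<le> c" "\<epsilon> + c + 2 * \<delta> < d x z" "\<epsilon> + c + 2 * \<delta> < d y z"
        and fl: "\<lfloor>d x (\<phi> h z)\<rfloor> = \<lfloor>d x (\<phi> g z)\<rfloor>" for h z
    proof -
      have gh: "g \<in> carrier G" "h \<in> carrier G" using g h by (auto simp: almost_stab_def)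
      have zX: "\<phi> g z \<in> X" "\<phi> h z \<in> X" using gh z act_in by auto
      have "d (\<phi> (inv g \<otimes> h) z) z = d (\<phi> g (\<phi> (inv g \<otimes> h) z)) (\<phi> g z)"
        using gh z act_in by (simp add: isometry)
      also have "\<phi> g (\<phi> (inv g \<otimes> h) z) = \<phi> (g \<otimes> (inv g \<otimes> h)) z"
        using gh z by (simp add: act_mult)
      also have "g \<otimes> (inv g \<otimes> h) = h" using gh by (simp add: m_assoc[symmetric])
      also have "d (\<phi> h z) (\<phi> g z) \<le> \<bar>d x (\<phi> h z) - d x (\<phi> g z)\<bar> + 2 * (c + 2 * \<delta>) + 2 * \<delta>"
        using gp_moved_far[OF g X(1,2) z] gp_moved_far[OF h X(1,2) z] zX X
        by (intro dist_le_of_gp_le[where y = y]) auto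
      also have "\<bar>d x (\<phi> h z) - d x (\<phi> g z)\<bar> \<le> 1" using fl by linarith
      finally show ?thesis by simp
    qed
    \<comment> \<open>Each fibre of \<open>f\<close> lies in a left translate of one almost
      stabilizer whose constant does not involve \<epsilon>.\<close>
    have sub: "{h \<in> ?A. f h = f g} \<subseteq> (\<lambda>h. g \<otimes> h) ` ?S"
    proof
      fix h
      assume h: "h \<in> {h \<in> ?A. f h = f g}"
      then have gh: "g \<in> carrier G" "h \<in> carrier G" using g by (auto simp: almost_stab_def)
      have "inv g \<otimes> h \<in> ?S"
        using h close[of h p] close[of h q] X c far gh by (simp add: almost_stab_def f_def)
      moreover have "h = g \<otimes> (inv g \<otimes> h)" using gh by (simp add: m_assoc[symmetric])
      ultimately show "h \<in> (\<lambda>h. g \<otimes> h) ` ?S" by blast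
    qed
    have "small ((\<lambda>h. g \<otimes> h) ` ?S) (card ?S)"
      using M by (intro small_image) (simp add: small_def)
    then have "small {h \<in> ?A. f h = f g} (card ?S)"
      by (rule small_subset[OF _ sub order_refl])
    then show ?thesis unfolding small_def of_nat_le_iff .
  qed
  ultimately have A: "finite ?A \<and> card ?A \<le> card ?B * card ?S"
    by (intro finite_card_fibres[where f = f]) auto
  then have "real (card ?A) \<le> real (card ?B * card ?S)" by (simp only: of_nat_le_iff)
  also have "\<dots> \<le> real (card ?B) * M"
    using M by (simp add: small_def mult_left_mono del: card_cartesian_product)
  also have "real (card ?B) = (\<lceil>2 * \<epsilon>\<rceil> + 1)\<^sup>2"
    using \<open>0 \<le> \<epsilon>\<close> by (simp add: power2_eq_square)
  finally show ?thesis using A by (simp only: small_def)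
qed

end

section \<open>Separated families of subgroups\<close>

text \<open>The number in \<open>displaced\<close> exceeds twice the length
  \<open>2 * C + 3 * \<delta>\<close> from \<open>broken_geodesic\<close>, so a segment keeps half
  its length after the loss at the corners; the 1 gives strictness and a displacement of at least
  1.\<close>

locale separated_family =
  hyperbolic_action X d \<delta> G \<phi> x\<^sub>0 + subgroup_family G I K
  for X :: "'x set" and d \<delta> and G :: "('g, 'b) monoid_scheme" (structure) and \<phi> and x\<^sub>0
    and I :: "'i set" and K +
  fixes C :: real
  assumes C_nonneg: "0 \<le> C"
    and separated: "\<lbrakk>i \<in> I; j \<in> I; i \<noteq> j; a \<in> K i; b \<in> K j\<rbrakk> \<Longrightarrow> gp x\<^sub>0 (pt a) (pt b) \<le> C"
    and displaced: "\<lbrakk>i \<in> I; a \<in> K i; a \<noteq> \<one>\<rbrakk> \<Longrightarrow> 4 * C + 6 * \<delta> + 1 \<le> disp a"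
begin

lemma letter_displaced:
  assumes "w \<in> fp_words I Gs" "reduced_word G w" "j < length w"
  shows "4 * C + 6 * \<delta> + 1 \<le> disp (snd (w ! j))"
  using displaced[of "fst (w ! j)" "snd (w ! j)"] words_nth[OF assms(1,3)] assms(2,3)
  by (auto simp: reduced_word_def)

lemma path_step:
  assumes "w \<in> fp_words I Gs" "u \<in> carrier G" "j < length w"
  shows "d (pt (u \<otimes> wval (take j w))) (pt (u \<otimes> wval (take (Suc j) w))) = disp (snd (w ! j))"
proof -
  have "snd (w ! j) \<in> carrier G"
    using words_nth[OF assms(1,3)] letter_closed by blast
  then show ?thesis
    using dist_pt_mult[of "u \<otimes> wval (take j w)" "snd (w ! j)"] wval_take_Suc[OF assms(1,3)]
      wval_closed[OF words_take[OF assms(1)]] assms(2) by (simp add: m_assoc)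
qed

text \<open>Moving a corner back to \<open>x\<^sub>0\<close> turns its neighbours into the orbit
  points of \<open>inv a\<close> and \<open>b\<close> for consecutive letters \<open>a\<close>,
  \<open>b\<close>. In a reduced word these lie in different subgroups, so \<open>separated\<close>
  bounds the product. The starting element \<open>u\<close> allows any two points of the orbit as
  endpoints.\<close>

lemma broken_geodesic_path:
  assumes w: "w \<in> fp_words I Gs" "reduced_word G w" and u: "u \<in> carrier G"
  shows "broken_geodesic X d \<delta> (\<lambda>j. pt (u \<otimes> wval (take j w))) (length w) C"
proof
  show "0 \<le> C" by (rule C_nonneg)
  have c: "u \<otimes> wval (take j w) \<in> carrier G" for j
    using u wval_closed[OF words_take[OF w(1)]] by simp
  show "pt (u \<otimes> wval (take j w)) \<in> X" for j
    by (rule pt_in[OF c])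
  show "2 * C + 3 * \<delta> < d (pt (u \<otimes> wval (take j w))) (pt (u \<otimes> wval (take (Suc j) w)))"
    if "j < length w" for j
    using path_step[OF w(1) u that] letter_displaced[OF w that] C_nonneg delta_nonneg by simp
  fix j
  assume j: "Suc j < length w"
  let ?v = "u \<otimes> wval (take (Suc j) w)" and ?a = "snd (w ! j)" and ?b = "snd (w ! Suc j)"
  have a: "fst (w ! j) \<in> I" "?a \<in> K (fst (w ! j))" and b: "fst (w ! Suc j) \<in> I" "?b \<in> K (fst (w ! Suc j))"
    using words_nth[OF w(1)] j by auto
  have ab: "?a \<in> carrier G" "?b \<in> carrier G"
    using letter_closed[OF a] letter_closed[OF b] by auto
  have ne: "fst (w ! j) \<noteq> fst (w ! Suc j)"
    using w(2) j distinct_adj_nth[of "map fst w" j] by (simp add: reduced_word_def)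
  have t: "wval (take i w) \<in> carrier G" for i
    by (rule wval_closed[OF words_take[OF w(1)]])
  have "?v = (u \<otimes> wval (take j w)) \<otimes> ?a"
    using wval_take_Suc[OF w(1), of j] j u t ab by (simp add: m_assoc)
  then have "u \<otimes> wval (take j w) = ?v \<otimes> inv ?a"
    using c ab by (simp add: m_assoc)
  then have prev: "pt (u \<otimes> wval (take j w)) = \<phi> ?v (pt (inv ?a))"
    using act_mult[OF c, of "inv ?a" x\<^sub>0] ab base_in by simp
  have "u \<otimes> wval (take (Suc (Suc j)) w) = ?v \<otimes> ?b"
    using wval_take_Suc[OF w(1) j] u t ab by (simp add: m_assoc)
  then have succ: "pt (u \<otimes> wval (take (Suc (Suc j)) w)) = \<phi> ?v (pt ?b)"
    using act_mult[OF c, of ?b x\<^sub>0] ab base_in by simp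
  have "inv ?a \<in> K (fst (w ! j))"
    using subgroup.m_inv_closed[OF subgroups[OF a(1)] a(2)] .
  then have "gp x\<^sub>0 (pt (inv ?a)) (pt ?b) \<le> C"
    using a b ne by (intro separated)
  then show "gp (pt ?v) (pt (u \<otimes> wval (take j w))) (pt (u \<otimes> wval (take (Suc (Suc j)) w))) \<le> C"
    unfolding prev succ using gp_act[OF c] ab base_in pt_in by simp
qed

text \<open>By \<open>dist_ge_sum\<close> a segment loses \<open>2 * C + 2 * \<delta>\<close>, which
  is at most half its length by \<open>letter_displaced\<close>.\<close>

lemma disp_wval_ge:
  assumes w: "w \<in> fp_words I Gs" "reduced_word G w"
  shows "(\<Sum>j<length w. disp (snd (w ! j))) \<le> 2 * disp (wval w)"
proof -
  interpret broken_geodesic X d \<delta> "\<lambda>j. pt (\<one> \<otimes> wval (take j w))" "length w" C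
    by (rule broken_geodesic_path[OF w one_closed])
  have "disp (snd (w ! j)) / 2
      \<le> d (pt (\<one> \<otimes> wval (take j w))) (pt (\<one> \<otimes> wval (take (Suc j) w))) - 2 * C - 2 * \<delta>"
    if "j < length w" for j
    unfolding path_step[OF w(1) one_closed that]
    using letter_displaced[OF w that] C_nonneg delta_nonneg by simp
  then have "(\<Sum>j<length w. disp (snd (w ! j)) / 2) \<le> (\<Sum>j<length w.
      d (pt (\<one> \<otimes> wval (take j w))) (pt (\<one> \<otimes> wval (take (Suc j) w))) - 2 * C - 2 * \<delta>)"
    by (intro sum_mono) simp
  also have "\<dots> \<le> disp (wval w)"
    using dist_ge_sum[of "length w"] wval_closed[OF w(1)] base_in by (simp add: act_one)
  finally show ?thesis by (simp add: sum_divide_distrib[symmetric])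
qed

lemma reduced_word_nontrivial:
  assumes w: "w \<in> fp_words I Gs" "reduced_word G w" "w \<noteq> []"
  shows "wval w \<noteq> \<one>"
proof
  assume "wval w = \<one>"
  then have "(\<Sum>j<length w. disp (snd (w ! j))) \<le> 0"
    using disp_wval_ge[OF w(1,2)] disp_one by simp
  moreover have "(\<Sum>j<length w. 1 :: real) \<le> (\<Sum>j<length w. disp (snd (w ! j)))"
  proof (rule sum_mono)
    fix j assume "j \<in> {..<length w}"
    then show "1 \<le> disp (snd (w ! j))"
      using letter_displaced[OF w(1,2), of j] C_nonneg delta_nonneg by simp
  qed
  moreover have "0 < real (length w)" using w(3) by simp
  ultimately show False by simp
qed

text \<open>A reduced word is expressed over the generators letter by letter, and
  \<open>disp_wval_ge\<close> compares the total displacement of its letters with that of the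
  product. Nontrivial letters have displacement at least 1, so the constants \<open>B i\<close> are
  absorbed in the factor and the additive constant is 0.\<close>

lemma undistorted_union:
  assumes I: "finite I"
    and S: "\<And>i. i \<in> I \<Longrightarrow> generate G (S i) = K i" "\<And>i. i \<in> I \<Longrightarrow> undistorted (S i) (L i) (B i)"
  shows "generate G (\<Union>i\<in>I. S i) = generate G (\<Union>i\<in>I. K i)"
    and "undistorted (\<Union>i\<in>I. S i) (1 + 2 * (\<Sum>i\<in>I. L i + B i)) 0"
proof -
  let ?S = "\<Union>i\<in>I. S i" and ?M = "\<Sum>i\<in>I. L i + B i"
  have Si: "finite (S i)" "S i \<subseteq> carrier G" "1 \<le> L i" "0 \<le> B i"
    "\<And>h. h \<in> K i \<Longrightarrow> word_length G (S i) h \<le> L i * disp h + B i" if "i \<in> I" for i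
    using S[OF that] by (auto simp: undistorted_def)
  have Sc: "?S \<subseteq> carrier G" using Si(2) by blast
  show gen: "generate G ?S = generate G (\<Union>i\<in>I. K i)"
  proof
    have "?S \<subseteq> (\<Union>i\<in>I. K i)" using S(1) generate.incl[of _ _ G] by blast
    then show "generate G ?S \<subseteq> generate G (\<Union>i\<in>I. K i)" by (rule mono_generate)
    have "K i \<subseteq> generate G ?S" if "i \<in> I" for i
      using mono_generate[of "S i" ?S] S(1)[OF that] that by blast
    then show "generate G (\<Union>i\<in>I. K i) \<subseteq> generate G ?S"
      by (intro generate_subgroup_incl generate_is_subgroup Sc) blast
  qed
  have M: "0 \<le> ?M" using Si(3,4) by (intro sum_nonneg) force
  have letter: "word_length G ?S a \<le> ?M * disp a" if a: "i \<in> I" "a \<in> K i" "a \<noteq> \<one>" for i a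
  proof -
    have "1 \<le> disp a" using displaced[OF a] C_nonneg delta_nonneg by simp
    have "real (word_length G ?S a) \<le> word_length G (S i) a"
      using word_length_antimono[of "S i" ?S a] Si(2)[OF a(1)] S(1) a by auto
    also have "\<dots> \<le> L i * disp a + B i" using Si(5)[OF a(1,2)] .
    also have "\<dots> \<le> (L i + B i) * disp a"
      using \<open>1 \<le> disp a\<close> mult_left_mono[of 1 "disp a" "B i"] Si(4)[OF a(1)] by (simp add: distrib_right)
    also have "L i + B i \<le> ?M"
      using I a(1) Si(3,4) by (intro member_le_sum) force+
    finally show ?thesis by (simp add: mult_right_mono)
  qed
  have word: "word_length G ?S (wval w) \<le> ?M * (\<Sum>j<length w. disp (snd (w ! j)))"
    if "w \<in> fp_words I Gs" "\<forall>x\<in>set w. snd x \<noteq> \<one>" for w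
    using that
  proof (induction w)
    case Nil
    then show ?case by simp
  next
    case (Cons x w)
    have gen': "snd x \<in> generate G ?S" "wval w \<in> generate G ?S"
      using Cons.prems wval_in_generate[of w] unfolding gen by (auto intro: generate.incl)
    have "real (word_length G ?S (snd x \<otimes> wval w)) 
        \<le> real (word_length G ?S (snd x)) + real (word_length G ?S (wval w))"
      using word_length_mult[OF Sc gen'] by linarith
    also have "\<dots> \<le> ?M * disp (snd x) + ?M * (\<Sum>j<length w. disp (snd (w ! j)))"
      using Cons letter[of "fst x" "snd x"] by (intro add_mono) auto
    also have "\<dots> = ?M * (\<Sum>j<length (x # w). disp (snd ((x # w) ! j)))"
      by (simp add: sum.lessThan_Suc_shift distrib_left del: sum.lessThan_Suc)
    finally show ?case by simp
  qed
  have "word_length G ?S g \<le> (1 + 2 * ?M) * disp g + 0" if g: "g \<in> generate G ?S" for g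
  proof -
    obtain w where w: "w \<in> fp_words I Gs" "reduced_word G w" "wval w = g"
      using generate_imp_reduced g unfolding gen by blast
    then have "word_length G ?S g \<le> ?M * (\<Sum>j<length w. disp (snd (w ! j)))"
      using word[of w] by (auto simp: reduced_word_def)
    also have "\<dots> \<le> ?M * (2 * disp g)"
      using disp_wval_ge[OF w(1,2)] M w(3) by (intro mult_left_mono) auto
    also have "\<dots> \<le> (1 + 2 * ?M) * disp g" by (simp add: algebra_simps)
    finally show ?thesis by simp
  qed
  then show "undistorted ?S (1 + 2 * ?M) 0"
    unfolding undistorted_def using I Si(1) Sc M by auto
qed

text \<open>The constant in \<open>short\<close> is the one that
  \<open>small_almost_stab_middle\<close> asks for when \<open>c\<close> is the bound
  \<open>C + 2 * \<delta>\<close> from \<open>gp_middle\<close>. It is the same for all \<epsilon>,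
  since \<open>short\<close> covers even the shortest nontrivial letters; in \<open>long\<close> the
  threshold may depend on \<epsilon>.\<close>

lemma acylindrical_along_generate:
  assumes short: "\<And>i a. \<lbrakk>i \<in> I; a \<in> K i; a \<noteq> \<one>\<rbrakk> \<Longrightarrow>
      small (almost_stab (1 + 2 * (C + 4 * \<delta>) + 2 * \<delta>) x\<^sub>0 (pt a)) M0"
    and long: "\<And>\<epsilon>. 0 \<le> \<epsilon> \<Longrightarrow> \<exists>M. \<forall>i\<in>I. \<forall>a\<in>K i. M \<le> disp a \<longrightarrow> small (almost_stab \<epsilon> x\<^sub>0 (pt a)) M"
  shows "acylindrical_along G d \<phi> (pt ` generate G (\<Union>i\<in>I. K i))"
  unfolding acylindrical_along_def
proof (intro allI impI)
  fix \<epsilon> :: real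
  assume eps: "0 \<le> \<epsilon>"
  let ?K = "generate G (\<Union>i\<in>I. K i)"
  let ?c = "C + 2 * \<delta>"
  \<comment> \<open>\<open>\<epsilon>'\<close> is the displacement that
    \<open>displacement_near_geodesic\<close> allows at the corners, and \<open>E\<close> a distance
    from the endpoints at which \<open>gp_moved_far\<close> applies.\<close>
  define \<epsilon>' where "\<epsilon>' = 3 * \<epsilon> + 2 * ?c + 2 * \<delta>"
  define E where "E = \<epsilon> + ?c + 2 * \<delta> + 1"
  have nn: "0 \<le> \<epsilon>'" "0 < E" using eps C_nonneg delta_nonneg by (auto simp: \<epsilon>'_def E_def)
  obtain M1 where M1: "\<And>i a. \<lbrakk>i \<in> I; a \<in> K i; M1 \<le> disp a\<rbrakk> \<Longrightarrow> small (almost_stab \<epsilon>' x\<^sub>0 (pt a)) M1"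
    using long[OF nn(1)] by blast
  define R1 where "R1 = max M1 0"
  \<comment> \<open>If all segments are shorter than \<open>R1\<close>, this separation leaves room
    for a segment with both ends at least \<open>E\<close> away from \<open>x\<close> and from
    \<open>y\<close>.\<close>
  define R where "R = 2 * E + 2 * R1 + 1"
  define N :: real where "N = (\<lceil>2 * \<epsilon>\<rceil> + 1)\<^sup>2 * M0"
  define M where "M = max 1 (max M1 N)"
  have "small (almost_stab \<epsilon> x y) M" if xy: "x \<in> pt ` ?K" "y \<in> pt ` ?K" "R \<le> d x y" for x y
  proof -
    obtain u v where uv: "u \<in> ?K" "x = pt u" "v \<in> ?K" "y = pt v" using xy by blast
    have uvc: "u \<in> carrier G" "v \<in> carrier G"
      using uv generate_in_carrier[OF generators_subset] by auto
    have "inv u \<otimes> v \<in> ?K"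
      using uv generate_is_subgroup[OF generators_subset] by (simp add: subgroup.m_closed subgroup.m_inv_closed)
    then obtain w where w: "w \<in> fp_words I Gs" "reduced_word G w" "wval w = inv u \<otimes> v"
      using generate_imp_reduced by blast
    define p where "p j = pt (u \<otimes> wval (take j w))" for j
    interpret broken_geodesic X d \<delta> p "length w" C
      unfolding p_def by (rule broken_geodesic_path[OF w(1,2) uvc(1)])
    have ends: "p 0 = x" "p (length w) = y"
      using uv uvc w(3) by (simp_all add: p_def m_assoc[symmetric])
    have X: "x \<in> X" "y \<in> X" using uv uvc pt_in by auto
    have near: "gp (p j) x y \<le> ?c" if "j \<le> length w" for j
      using gp_middle[OF that] ends by simp
    have letter: "fst (w ! j) \<in> I" "snd (w ! j) \<in> K (fst (w ! j))" "snd (w ! j) \<noteq> \<one>"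
      "d (p j) (p (Suc j)) = disp (snd (w ! j))" if "j < length w" for j
      using words_nth[OF w(1) that] w(2) that path_step[OF w(1) uvc(1) that]
      by (auto simp: reduced_word_def p_def)
    have transfer: "small (almost_stab e (p j) (p (Suc j))) m"
      if "j < length w" "small (almost_stab e x\<^sub>0 (pt (snd (w ! j)))) m" for j e m
    proof -
      let ?v = "u \<otimes> wval (take j w)" and ?a = "snd (w ! j)"
      have c: "?v \<in> carrier G" "?a \<in> carrier G" "wval (take j w) \<in> carrier G"
        using uvc wval_closed[OF words_take[OF w(1)]] letter_closed letter[OF that(1)] by auto
      have "p (Suc j) = \<phi> ?v (pt ?a)"
        using wval_take_Suc[OF w(1) that(1)] c uvc base_in
        by (simp add: p_def m_assoc[symmetric] act_mult[symmetric] del: act_mult)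
      moreover have "p j = \<phi> ?v x\<^sub>0" by (simp add: p_def)
      ultimately show ?thesis
        using almost_stab_translate[OF c(1) base_in pt_in[OF c(2)], of e]
          small_subset[OF small_image[OF that(2)]] by auto
    qed
    show ?thesis
    proof (cases "\<exists>j<length w. R1 \<le> disp (snd (w ! j))")
      case True
      then obtain j where j: "j < length w" "R1 \<le> disp (snd (w ! j))" by blast
      have "small (almost_stab \<epsilon>' x\<^sub>0 (pt (snd (w ! j)))) M1"
        using M1[of "fst (w ! j)" "snd (w ! j)"] letter[OF j(1)] j(2) by (simp add: R1_def)
      then have "small (almost_stab \<epsilon>' (p j) (p (Suc j))) M1" by (rule transfer[OF j(1)])
      moreover have "almost_stab \<epsilon> x y \<subseteq> almost_stab \<epsilon>' (p j) (p (Suc j))"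
      proof
        fix g
        assume g: "g \<in> almost_stab \<epsilon> x y"
        then have "d (\<phi> g (p k)) (p k) \<le> \<epsilon>'" if "k \<le> length w" for k
          unfolding \<epsilon>'_def using displacement_near_geodesic[OF g X p_in near eps] that by blast
        then show "g \<in> almost_stab \<epsilon>' (p j) (p (Suc j))"
          using g j(1) by (simp add: almost_stab_def)
      qed
      ultimately show ?thesis by (rule small_subset) (simp add: M_def)
    next
      case False
      then have step: "d (p j) (p (Suc j)) < R1" if "j < length w" for j
        using letter[OF that] that by force
      have "0 \<le> R1" by (simp add: R1_def)
      have ex: "E \<le> d x (p (length w))"
        using xy(3) nn \<open>0 \<le> R1\<close> by (simp add: ends R_def)
      \<comment> \<open>The first corner at distance at least \<open>E\<close> from
        \<open>x\<close>. Its predecessor is closer than \<open>E\<close> and the segment between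
        them is short, so it lies within \<open>E + R1\<close> of \<open>x\<close> and far from
        \<open>y\<close>.\<close>
      define j where "j = (LEAST j. E \<le> d x (p j))"
      have j: "E \<le> d x (p j)" "j \<le> length w"
        unfolding j_def using ex by (auto intro: LeastI Least_le)
      have "j \<noteq> 0" using j(1) ends(1) X nn by (intro notI) simp
      then obtain i where i: "j = Suc i" by (cases j) auto
      then have "d x (p i) < E" using not_less_Least[of i "\<lambda>j. E \<le> d x (p j)"] by (simp add: j_def)
      moreover have "d x (p j) \<le> d x (p i) + d (p i) (p j)"
        using X p_in[of i] p_in[of j] i j by (intro triangle) auto
      ultimately have up: "d x (p j) < E + R1" using step[of i] i j(2) by simp
      have "d x y \<le> d x (p j) + d (p j) y" using X p_in[OF j(2)] by (intro triangle)
      then have yj: "E + R1 < d (p j) y" using up xy(3) by (simp add: R_def)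
      then have jl: "j < length w"
        using j(2) ends(2) X nn \<open>0 \<le> R1\<close> by (cases "j = length w") auto
      have "d (p j) y \<le> d (p j) (p (Suc j)) + d (p (Suc j)) y"
        using X p_in[of j] p_in[of "Suc j"] jl by (intro triangle) auto
      then have yj': "E < d (p (Suc j)) y" using yj step[OF jl] by simp
      \<comment> \<open>Distances from the start of a broken geodesic do not decrease along it, so
        the next corner is far from \<open>x\<close> as well.\<close>
      have xj': "E \<le> d x (p (Suc j))" using j(1) dist_start_mono[OF jl] ends by simp
      have "small (almost_stab (1 + 2 * (C + 4 * \<delta>) + 2 * \<delta>) (p j) (p (Suc j))) M0"
        by (rule transfer[OF jl short]) (use letter[OF jl] in auto)
      moreover have "?c + 2 * \<delta> = C + 4 * \<delta>" by simp
      ultimately have "small (almost_stab \<epsilon> x y) N"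
        unfolding N_def using X p_in[of j] p_in[of "Suc j"] near[of j] near[of "Suc j"] jl eps j(1) yj yj' xj'
          \<open>0 \<le> R1\<close>
        by (intro small_almost_stab_middle[where p = "p j" and q = "p (Suc j)" and c = ?c])
          (auto simp: E_def commute)
      then show ?thesis by (rule small_subset) (auto simp: M_def)
    qed
  qed
  then show "\<exists>R>0. \<exists>M>0. \<forall>x\<in>pt ` ?K. \<forall>y\<in>pt ` ?K. R \<le> d x y \<longrightarrow>
      finite {g \<in> carrier G. d (\<phi> g x) x \<le> \<epsilon> \<and> d (\<phi> g y) y \<le> \<epsilon>} \<and>
      real (card {g \<in> carrier G. d (\<phi> g x) x \<le> \<epsilon> \<and> d (\<phi> g y) y \<le> \<epsilon>}) \<le> M"
    unfolding almost_stab_def small_def using nn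
    by (intro exI[of _ R] exI[of _ M] conjI) (auto simp: R_def M_def R1_def)
qed

end

section \<open>Acylindricity of a subgroup seen from the fixed base point\<close>

context hyperbolic_action
begin

text \<open>Acylindricity may be given along the orbit of another point \<open>x\<close>, so
  \<epsilon> and the separation are enlarged by \<open>2 * d x x\<^sub>0\<close>. One number
  \<open>M\<close> serves as displacement threshold and as cardinality bound, which makes the
  property monotone in \<open>M\<close>.\<close>

lemma acylindrical_along_subgroup_small:
  assumes H: "subgroup H G" and acyl: "acylindrical_along_subgroup G X d \<phi> H" and "0 \<le> \<epsilon>"
  shows "\<exists>M. \<forall>a\<in>H. M \<le> disp a \<longrightarrow> small (almost_stab \<epsilon> x\<^sub>0 (pt a)) M"
proof -
  obtain x where x: "x \<in> X" and ac: "acylindrical_along G d \<phi> ((\<lambda>h. \<phi> h x) ` H)"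
    using acyl by (auto simp: acylindrical_along_subgroup_def)
  let ?e = "\<epsilon> + 2 * d x x\<^sub>0"
  have e: "0 \<le> ?e" using \<open>0 \<le> \<epsilon>\<close> by simp
  have "\<exists>R M. \<forall>y\<in>(\<lambda>h. \<phi> h x) ` H. \<forall>z\<in>(\<lambda>h. \<phi> h x) ` H. R \<le> d y z \<longrightarrow>
      small (almost_stab ?e y z) M"
    using ac[unfolded acylindrical_along_def, rule_format, OF e]
    unfolding small_def almost_stab_def by (elim exE conjE) (intro exI)
  then obtain R M where "\<forall>y\<in>(\<lambda>h. \<phi> h x) ` H. \<forall>z\<in>(\<lambda>h. \<phi> h x) ` H. R \<le> d y z \<longrightarrow>
      small (almost_stab ?e y z) M" by (elim exE)
  then have RM: "small (almost_stab ?e y z) M"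
    if "y \<in> (\<lambda>h. \<phi> h x) ` H" "z \<in> (\<lambda>h. \<phi> h x) ` H" "R \<le> d y z" for y z
    using that by blast
  have shift: "d (\<phi> g (\<phi> h x)) (\<phi> h x) \<le> d (\<phi> g (pt h)) (pt h) + 2 * d x x\<^sub>0"
    if gh: "g \<in> carrier G" "h \<in> carrier G" for g h
  proof -
    have hX: "\<phi> h x \<in> X" "pt h \<in> X" "\<phi> g (\<phi> h x) \<in> X" "\<phi> g (pt h) \<in> X"
      using gh x base_in act_in by auto
    have "d (\<phi> h x) (pt h) = d x x\<^sub>0" "d (\<phi> g (\<phi> h x)) (\<phi> g (pt h)) = d x x\<^sub>0"
      using gh x base_in hX by (simp_all add: isometry)
    then show ?thesis
      using triangle[OF hX(3,4,1)] triangle[OF hX(4,2,1)] commute[of "pt h" "\<phi> h x"] by simp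
  qed
  have "small (almost_stab \<epsilon> x\<^sub>0 (pt a)) (max M (R + 2 * d x x\<^sub>0))"
    if a: "a \<in> H" "max M (R + 2 * d x x\<^sub>0) \<le> disp a" for a
  proof -
    have ac: "a \<in> carrier G" using H a(1) by (rule subgroup.mem_carrier)
    have aX: "\<phi> a x \<in> X" "pt a \<in> X" using ac x base_in act_in by auto
    have "d (\<phi> a x) (pt a) = d x x\<^sub>0" using ac x base_in by (simp add: isometry)
    then have "disp a \<le> d x (\<phi> a x) + 2 * d x x\<^sub>0"
      using triangle[OF base_in x aX(2)] triangle[OF x aX] commute[of x x\<^sub>0] by simp
    then have "R \<le> d (\<phi> \<one> x) (\<phi> a x)" using a(2) x by (simp add: act_one)
    then have "small (almost_stab ?e (\<phi> \<one> x) (\<phi> a x)) M"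
      using a(1) subgroup.one_closed[OF H] by (intro RM) auto
    moreover have "almost_stab \<epsilon> x\<^sub>0 (pt a) \<subseteq> almost_stab ?e (\<phi> \<one> x) (\<phi> a x)"
    proof
      fix g
      assume g: "g \<in> almost_stab \<epsilon> x\<^sub>0 (pt a)"
      then have gc: "g \<in> carrier G" by (simp add: almost_stab_def)
      show "g \<in> almost_stab ?e (\<phi> \<one> x) (\<phi> a x)"
        using g shift[OF gc one_closed] shift[OF gc ac] base_in by (simp add: almost_stab_def act_one)
    qed
    ultimately show ?thesis by (rule small_subset) simp
  qed
  then show ?thesis by blast
qed

end

section \<open>Uniform constants, the excluded set and the conclusion\<close>

lemma finite_uniform_bound:
  fixes P :: "'i \<Rightarrow> real \<Rightarrow> bool"
  assumes "finite I" "\<And>i. i \<in> I \<Longrightarrow> \<exists>r. P i r" and mono: "\<And>i r s. P i r \<Longrightarrow> r \<le> s \<Longrightarrow> P i s"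
  shows "\<exists>r\<ge>0. \<forall>i\<in>I. P i r"
proof -
  obtain f where f: "\<And>i. i \<in> I \<Longrightarrow> P i (f i)" using assms(2) by metis
  have "f i \<le> (\<Sum>i\<in>I. \<bar>f i\<bar>)" if "i \<in> I" for i
    using member_le_sum[of i I "\<lambda>i. \<bar>f i\<bar>"] that assms(1) by fastforce
  then have "\<forall>i\<in>I. P i (\<Sum>i\<in>I. \<bar>f i\<bar>)" using mono[OF f] by blast
  then show ?thesis by (intro exI[of _ "\<Sum>i\<in>I. \<bar>f i\<bar>"] conjI sum_nonneg) simp_all
qed

theorem theorem1p4:
  fixes G (structure)
    and X :: "'x set" and d :: "'x \<Rightarrow> 'x \<Rightarrow> real" and \<phi> :: "'g \<Rightarrow> 'x \<Rightarrow> 'x"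
    and x\<^sub>0 :: 'x and k :: nat and H :: "nat \<Rightarrow> 'g set"
  assumes "group G"
    and "hyperbolic_space X d"
    and "isometric_action G X d \<phi>"
    and "x\<^sub>0 \<in> X"
    and "\<And>i. i \<in> {1..k} \<Longrightarrow> subgroup (H i) G"
    and "\<And>i. i \<in> {1..k} \<Longrightarrow> AQI_triple G X d \<phi> (H i)"
    and "\<And>i j. i \<in> {1..k} \<Longrightarrow> j \<in> {1..k} \<Longrightarrow> i \<noteq> j \<Longrightarrow>
           limit_set X d \<phi> x\<^sub>0 (H i) \<inter> limit_set X d \<phi> x\<^sub>0 (H j) = {}"
  shows "\<exists>S. finite S \<and> S \<subseteq> (\<Union>i\<in>{1..k}. H i) - {\<one>} \<and>
    (\<forall>K :: nat \<Rightarrow> 'g set.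
      (\<forall>i\<in>{1..k}. qi_embedded_subgroup G (K i) (H i) \<and> K i \<inter> S = {}) \<longrightarrow>
      free_product_map G
        \<in> iso (free_product {1..k} (\<lambda>i. G\<lparr>carrier := K i\<rparr>))
              (G\<lparr>carrier := generate G (\<Union>i\<in>{1..k}. K i)\<rparr>) \<and>
      acylindrical_along_subgroup G X d \<phi> (generate G (\<Union>i\<in>{1..k}. K i)) \<and>
      qi_embedded_by_action G X d \<phi> (generate G (\<Union>i\<in>{1..k}. K i)) \<and>
      (infinite (generate G (\<Union>i\<in>{1..k}. K i)) \<longrightarrow>
        AQI_triple G X d \<phi> (generate G (\<Union>i\<in>{1..k}. K i))))"
proof -
  let ?I = "{1..k}"
  obtain \<delta> where \<delta>: "0 \<le> \<delta>" "\<And>w x y z. \<lbrakk>w \<in> X; x \<in> X; y \<in> X; z \<in> X\<rbrakk> \<Longrightarrow>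
      min (gromov_product d w x y) (gromov_product d w y z) - \<delta> \<le> gromov_product d w x z"
    using assms(2) unfolding hyperbolic_space_def gromov_hyperbolic_def by blast
  have "Metric_space X d"
    using assms(2) by (simp add: hyperbolic_space_def geodesic_metric_space_def)
  moreover have "group_action G X \<phi>"
    "\<And>g x y. \<lbrakk>g \<in> carrier G; x \<in> X; y \<in> X\<rbrakk> \<Longrightarrow> d (\<phi> g x) (\<phi> g y) = d x y"
    using assms(3) by (auto simp: isometric_action_def)
  ultimately interpret hyperbolic_action X d \<delta> G \<phi> x\<^sub>0
    using assms(1,4) \<delta>
    by (intro hyperbolic_action.intro gromov_hyperbolic_metric.intro gromov_hyperbolic_metric_axioms.intro
        hyperbolic_action_axioms.intro)
  have sub: "subgroup (H i) G" if "i \<in> ?I" for i using assms(5) that .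
  have "\<forall>i\<in>?I. \<exists>T L B. finite_generating_set G (H i) T \<and> undistorted T L B"
    using assms(6) qi_embedded_imp_undistorted unfolding AQI_triple_def by metis
  then obtain T L B where T: "\<And>i. i \<in> ?I \<Longrightarrow> finite_generating_set G (H i) (T i)"
    and und: "\<And>i. i \<in> ?I \<Longrightarrow> undistorted (T i) (L i) (B i)"
    by metis
  have gen: "generate G (T i) = H i" if "i \<in> ?I" for i
    using T[OF that] by (simp add: finite_generating_set_def)
  \<comment> \<open>The property is stated for pairs of indices so that
    \<open>finite_uniform_bound\<close> gives one \<open>C\<close> for all of them; on the diagonal
    it holds trivially.\<close>
  define sep where "sep ij C \<longleftrightarrow> fst ij \<noteq> snd ij \<longrightarrow>
      (\<forall>a\<in>H (fst ij). \<forall>b\<in>H (snd ij). gp x\<^sub>0 (pt a) (pt b) \<le> C)" for ij :: "nat \<times> nat" and C :: real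
  have "\<exists>C\<ge>0. \<forall>ij\<in>?I \<times> ?I. sep ij C"
  proof (rule finite_uniform_bound)
    fix ij
    assume ij: "ij \<in> ?I \<times> ?I"
    show "\<exists>C. sep ij C"
    proof (cases "fst ij = snd ij")
      case False
      then have "\<exists>C. \<forall>a\<in>generate G (T (fst ij)). \<forall>b\<in>H (snd ij). gp x\<^sub>0 (pt a) (pt b) \<le> C"
        using ij assms(7)[of "fst ij" "snd ij"] gen[of "fst ij"] subgroup.subset[OF sub[of "snd ij"]]
        by (intro disjoint_limit_sets_bound[OF und[of "fst ij"]]) auto
      moreover have "generate G (T (fst ij)) = H (fst ij)" using ij gen by auto
      ultimately show ?thesis unfolding sep_def by metis
    qed (simp add: sep_def)
  qed (auto simp: sep_def intro: order_trans)
  then obtain C where C: "0 \<le> C" "\<And>ij. ij \<in> ?I \<times> ?I \<Longrightarrow> sep ij C" by blast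
  define bound where "bound \<epsilon> i M \<longleftrightarrow> (\<forall>a\<in>H i. M \<le> disp a \<longrightarrow> small (almost_stab \<epsilon> x\<^sub>0 (pt a)) M)" for \<epsilon> i M
  have bound: "\<exists>M\<ge>0. \<forall>i\<in>?I. bound \<epsilon> i M" if "0 \<le> \<epsilon>" for \<epsilon>
  proof (rule finite_uniform_bound)
    show "\<exists>M. bound \<epsilon> i M" if "i \<in> ?I" for i
      unfolding bound_def using acylindrical_along_subgroup_small[OF sub[OF that] _ \<open>0 \<le> \<epsilon>\<close>] assms(6)[OF that]
      by (auto simp: AQI_triple_def)
    show "bound \<epsilon> i s" if "bound \<epsilon> i r" "r \<le> s" for i r s
      unfolding bound_def
    proof (intro ballI impI)
      fix a
      assume "a \<in> H i" "s \<le> disp a"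
      then have "small (almost_stab \<epsilon> x\<^sub>0 (pt a)) r" using that by (auto simp: bound_def)
      then show "small (almost_stab \<epsilon> x\<^sub>0 (pt a)) s" by (rule small_subset[OF _ order_refl that(2)])
    qed
  qed simp
  \<comment> \<open>The constant of \<open>acylindrical_along_generate\<close>. It depends on
    \<open>C\<close> and \<delta> only, hence is available before the subgroups \<open>K i\<close>
    are given.\<close>
  define \<epsilon>\<^sub>0 where "\<epsilon>\<^sub>0 = 1 + 2 * (C + 4 * \<delta>) + 2 * \<delta>"
  have "0 \<le> \<epsilon>\<^sub>0" using C(1) \<delta>(1) by (simp add: \<epsilon>\<^sub>0_def)
  then obtain M0 where M0: "\<And>i. i \<in> ?I \<Longrightarrow> bound \<epsilon>\<^sub>0 i M0" using bound by blast
  \<comment> \<open>The first entry provides the displacement required by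
    \<open>separated_family\<close>, the second the threshold for acylindricity at
    \<open>\<epsilon>\<^sub>0\<close>.\<close>
  define R where "R = max (4 * C + 6 * \<delta> + 1) M0"
  define S where "S = {h \<in> (\<Union>i\<in>?I. H i) - {\<one>}. disp h \<le> R}"
  have "finite (\<Union>i\<in>?I. {h \<in> H i. disp h \<le> R})"
    using finite_short[OF und] gen by auto
  then have "finite S" by (rule rev_finite_subset) (auto simp: S_def)
  moreover have "S \<subseteq> (\<Union>i\<in>?I. H i) - {\<one>}" by (auto simp: S_def)
  moreover have "free_product_map G
        \<in> iso (free_product ?I (\<lambda>i. G\<lparr>carrier := K i\<rparr>))
              (G\<lparr>carrier := generate G (\<Union>i\<in>?I. K i)\<rparr>) \<and>
      acylindrical_along_subgroup G X d \<phi> (generate G (\<Union>i\<in>?I. K i)) \<and>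
      qi_embedded_by_action G X d \<phi> (generate G (\<Union>i\<in>?I. K i)) \<and>
      (infinite (generate G (\<Union>i\<in>?I. K i)) \<longrightarrow>
        AQI_triple G X d \<phi> (generate G (\<Union>i\<in>?I. K i)))"
    if K: "\<forall>i\<in>?I. qi_embedded_subgroup G (K i) (H i) \<and> K i \<inter> S = {}" for K
  proof -
    let ?K = "generate G (\<Union>i\<in>?I. K i)"
    have KH: "K i \<subseteq> H i" "subgroup (K i) G" if "i \<in> ?I" for i
      using K that by (auto simp: qi_embedded_subgroup_def)
    have far: "R \<le> disp a" if "i \<in> ?I" "a \<in> K i" "a \<noteq> \<one>" for i a
    proof (rule ccontr)
      assume "\<not> R \<le> disp a"
      then have "a \<in> S" using that KH(1)[OF that(1)] by (auto simp: S_def)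
      then show False using K that by blast
    qed
    interpret separated_family X d \<delta> G \<phi> x\<^sub>0 ?I K C
    proof (intro separated_family.intro subgroup_family.intro subgroup_family_axioms.intro
        separated_family_axioms.intro)
      show "hyperbolic_action X d \<delta> G \<phi> x\<^sub>0" by (rule hyperbolic_action_axioms)
      show "group G" by (rule assms(1))
      show "0 \<le> C" by (rule C(1))
      show "gp x\<^sub>0 (pt a) (pt b) \<le> C" if "i \<in> ?I" "j \<in> ?I" "i \<noteq> j" "a \<in> K i" "b \<in> K j" for i j a b
        using C(2)[of "(i, j)"] that KH(1)[OF that(1)] KH(1)[OF that(2)] by (auto simp: sep_def)
      show "4 * C + 6 * \<delta> + 1 \<le> disp a" if "i \<in> ?I" "a \<in> K i" "a \<noteq> \<one>" for i a
        using far[OF that] by (simp add: R_def)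
    qed (rule KH(2))
    have "\<forall>i\<in>?I. \<exists>S L B. finite_generating_set G (K i) S \<and> undistorted S L B"
      using K undistorted_subgroup T und by metis
    then obtain S' L' B' where S': "\<And>i. i \<in> ?I \<Longrightarrow> generate G (S' i) = K i"
      "\<And>i. i \<in> ?I \<Longrightarrow> undistorted (S' i) (L' i) (B' i)"
      unfolding finite_generating_set_def by metis
    note union = undistorted_union[OF finite_atLeastAtMost S']
    have qi: "qi_embedded_by_action G X d \<phi> ?K"
      using undistorted_imp_qi_embedded[OF union(2)] union(1) by simp
    have "acylindrical_along G d \<phi> (pt ` ?K)"
    proof (rule acylindrical_along_generate)
      show "small (almost_stab (1 + 2 * (C + 4 * \<delta>) + 2 * \<delta>) x\<^sub>0 (pt a)) M0"
        if "i \<in> ?I" "a \<in> K i" "a \<noteq> \<one>" for i a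
        using M0[OF that(1)] far[OF that] that KH(1)[OF that(1)] by (auto simp: bound_def \<epsilon>\<^sub>0_def R_def)
      show "\<exists>M. \<forall>i\<in>?I. \<forall>a\<in>K i. M \<le> disp a \<longrightarrow> small (almost_stab \<epsilon> x\<^sub>0 (pt a)) M" if "0 \<le> \<epsilon>" for \<epsilon>
        using bound[OF that] KH(1) unfolding bound_def by blast
    qed
    then have acyl: "acylindrical_along_subgroup G X d \<phi> ?K"
      unfolding acylindrical_along_subgroup_def using base_in by blast
    \<comment> \<open>\<open>AQI_triple\<close> includes infinitude, while \<open>?K\<close> can be
      finite, for instance when every \<open>K i\<close> is trivial; therefore the last conjunct is
      an implication.\<close>
    have "subgroup ?K G" "\<exists>S. finite_generating_set G ?K S"
      using qi by (auto simp: qi_embedded_by_action_def)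
    then show ?thesis
      using free_product_iso[OF reduced_word_nontrivial] acyl qi assms(2,3)
      by (simp add: AQI_triple_def)
  qed
  ultimately show ?thesis by blast
qed

end
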